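(* Let $\varepsilon>0$ be the reference Mach number, $\gamma$ the specific heat ratio, and $\Omega$ the (two-dimensional) spatial domain. Consider the second-order semi-implicit deferred-correction (SI-DeC) time discretization which, from $(\rho^n,\boldsymbol u^n,p^n)$ at time $t^n$, produces $(\rho^{n+1},\boldsymbol u^{n+1},p^{n+1})$ at time $t^{n+1}=t^n+\Delta t$ in two stages. First stage: $$\rho^*=\rho^n-\Delta t\,\nabla\cdot(\rho^n\boldsymbol u^n),$$ $$\boldsymbol u^*=\boldsymbol u^n-\Delta t\Big[(\boldsymbol u^n\cdot\nabla)\boldsymbol u^n+\frac{\rho_{\max}^n-\rho^n}{\varepsilon^2\rho^n\rho_{\max}^n}\,\nabla p^n\Big]-\frac{\Delta t}{\varepsilon^2\rho_{\max}^n}\nabla p^*,$$ $$p^*=p^n-\Delta t\big[\boldsymbol u^n\cdot\nabla p^n+\gamma(p^n-p_{\min}^n)\nabla\cdot\boldsymbol u^n\big]-\Delta t\,\gamma p_{\min}^n\nabla\cdot\boldsymbol u^*.$$ Second stage: $$\rho^{n+1}=\rho^n-\frac{\Delta t}{2}\big[\nabla\cdot(\rho^n\boldsymbol u^n)+\nabla\cdot(\rho^*\boldsymbol u^* )\big],$$ $$\begin{aligned}\boldsymbol u^{n+1}=\boldsymbol u^n&-\frac{\Delta t}{2}\Big[(\boldsymbol u^n\cdot\nabla)\boldsymbol u^n+(\boldsymbol u^*\cdot\nabla)\boldsymbol u^*+\frac{\rho_{\max}^n-\rho^n}{\varepsilon^2\rho^n\rho_{\max}^n}\,\nabla p^n+\frac{\rho_{\max}^*-\rho^*}{\varepsilon^2\rho^*\rho_{\max}^*}\,\nabla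 p^*\Big]\\&-\frac{\Delta t}{2\varepsilon^2}\Big(\frac{\nabla p^n}{\rho_{\max}^n}-\frac{\nabla p^*}{\rho_{\max}^*}\Big)-\frac{\Delta t}{\varepsilon^2\rho_{\max}^*}\nabla p^{n+1},\end{aligned}$$ $$\begin{aligned}p^{n+1}=p^n&-\frac{\Delta t}{2}\big[\boldsymbol u^n\cdot\nabla p^n+\boldsymbol u^*\cdot\nabla p^*+\gamma(p^n-p_{\min}^n)\nabla\cdot\boldsymbol u^n+\gamma(p^*-p_{\min}^* )\nabla\cdot\boldsymbol u^*\big]\\&-\frac{\Delta t}{2}\,\gamma\big(p_{\min}^n\nabla\cdot\boldsymbol u^n-p_{\min}^*\nabla\cdot\boldsymbol u^*\big)-\Delta t\,\gamma p_{\min}^*\nabla\cdot\boldsymbol u^{n+1}.\end{aligned}$$ Here $\rho_{\max}^n:=\max_{(x,y)\in\Omega}\rho^n(x,y)$, $p_{\min}^n:=\min_{(x,y)\in\Omega}p^n(x,y)$, and $\rho_{\max}^*:=\max_{(x,y)\in\Omega}\rho^*(x,y)$, $p_{\min}^*:=\min_{(x,y)\in\Omega}p^*(x,y)$. Suppose that the time step is computed by $$\Delta t=K_{\rm CFL}\min\left\{\frac{\Delta x}{\max_{(x,y)\in\Omega}(|u|+\tilde c)},\ \frac{\Delta y}{\max_{(x,y)\in\Omega}(|v|+\tilde c)}\right\},\qquad \tilde c:=\frac1\varepsilon\sqrt{\gamma\,\frac{(\rho_{\max}-\rho)(p-p_{\min})}{\rho\,\rho_{\max}}},$$ where $K_{\rm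 CFL}$ is a CFL number and $\Delta x,\Delta y$ are the mesh sizes of the spatial discretization. Then this time discretization is asymptotic preserving (AP) in the sense of the definition given in the context.
   Context: Primitive system. The scheme discretizes in time (space is left continuous) the non-dimensional two-dimensional compressible Euler equations in primitive variables: density $\rho(x,y,t)$, velocity $\boldsymbol u=(u,v)^\top$, pressure $p$, for $(x,y)\in\Omega$: $$\rho_t+\nabla\cdot(\rho\boldsymbol u)=0,\qquad \boldsymbol u_t+(\boldsymbol u\cdot\nabla)\boldsymbol u+\frac{1}{\varepsilon^2\rho}\nabla p=\boldsymbol 0,\qquad p_t+\boldsymbol u\cdot\nabla p+\gamma p\,\nabla\cdot\boldsymbol u=0.$$ In the time-step formula, $\rho_{\max}=\max_{(x,y)\in\Omega}\rho$ and $p_{\min}=\min_{(x,y)\in\Omega}p$. Zero-Mach-number limit. The limiting equations as $\varepsilon\to0$ are $$\rho^{(0)}_t+\nabla\cdot(\rho^{(0)}\boldsymbol u^{(0)})=0,\tag{L1}$$ $$\boldsymbol u^{(0)}_t+(\boldsymbol u^{(0)}\cdot\nabla)\boldsymbol u^{(0)}+\frac{1}{\rho^{(0)}}\nabla p^{(2)}=\boldsymbol 0,\tag{L2}$$ $$\nabla\cdot\boldsymbol u^{(0)}=0,\quad p^{(0)}\equiv\overline p_0,\tag{L3}$$ and the correct low-Mach-number scaling of the ${\cal O}(\varepsilon)$ terms is $$\nabla\cdot\boldsymbol u^{(1)}=0,\quad p^{(1)}\equiv\overline p_1,\tag{L4}$$ where $\overline p_0>0$ and $\overline p_1$ are constants.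 Definition (AP time discretization). Assume that the semi-discrete (not discretized in space) solution $(\rho^n(x,y),\boldsymbol u^n(x,y),p^n(x,y))$ at time $t^n$ can be expanded as $$\rho^n=\rho^{(0),n}+\varepsilon\rho^{(1),n}+\varepsilon^2\rho^{(2),n}+\dots,\quad \boldsymbol u^n=\boldsymbol u^{(0),n}+\varepsilon\boldsymbol u^{(1),n}+\varepsilon^2\boldsymbol u^{(2),n}+\dots,\quad p^n=p^{(0),n}+\varepsilon p^{(1),n}+\varepsilon^2p^{(2),n}+\dots,\tag{E}$$ compatibly with the asymptotic limits (L3) and (L4), that is, $$p^{(0),n}\equiv\overline p_0,\quad p^{(1),n}\equiv\overline p_1,\quad \nabla\cdot\boldsymbol u^{(0),n}=0,\quad \nabla\cdot\boldsymbol u^{(1),n}=0,$$ and assume that the Dirichlet boundary condition $$p=\overline p_0+\varepsilon\,\overline p_1+\varepsilon^2p_2+\dots\quad\text{for all }(x,y)\in\partial\Omega$$ holds, where $p_k(x,y,t)$, $k\ge2$, are bounded functions. Consider a one-step time discretization that produces at time $t^{n+1}=t^n+\Delta t$ an approximation $(\rho^{n+1},\boldsymbol u^{n+1},p^{n+1})$. Such a time discretization is called AP if it admits an asymptotic expansion of the type (E) (with $n$ replaced by $n+1$) and yields a consistent discretization of (L1)–(L4) as $\varepsilon\to0$. Asymptotic expansions are understood in the formal sense (formal power series in $\varepsilon$). The Dirichlet boundary condition on the pressure is imposed at the intermediate stage $*$ as well as at $t^{n+1}$.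
   Formalization: Assumes the CFL denominators are nonzero and not both vanishing as ε→0 (fluid not at rest in the limit; otherwise Δt→∞ and the claim fails), Δt is a series in integer powers of ε, and the leading-order densities at t^n and stage * are positive. *)

theory Defs
  imports "HOL-Complex_Analysis.Complex_Analysis"
begin

section \<open>Formal series in the Mach number\<close>

text \<open>
  Asymptotic expansions are formal: an \<open>\<epsilon>\<close>-dependent number is an element of the field
  \<open>real fls\<close> of formal Laurent series, with \<open>\<epsilon> = fls_X\<close>.  Negative powers are needed because
  the scheme divides by \<open>\<epsilon>\<^sup>2\<close>.  The field is ordered by the sign of the leading coefficient,
  i.e. \<open>\<epsilon>\<close> is a positive infinitesimal, so \<open>max\<close>, \<open>min\<close> and \<open>\<bar>\<cdot>\<bar>\<close> in the scheme have a formal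
  meaning.
\<close>

instantiation fls :: (linordered_field) linordered_field
begin

definition less_fls :: "'a fls \<Rightarrow> 'a fls \<Rightarrow> bool" where
  "f < g \<longleftrightarrow> 0 < fls_nth (g - f) (fls_subdegree (g - f))"

definition less_eq_fls :: "'a fls \<Rightarrow> 'a fls \<Rightarrow> bool" where
  "(f :: 'a fls) \<le> g \<longleftrightarrow> f = g \<or> f < g"

definition abs_fls :: "'a fls \<Rightarrow> 'a fls" where
  "\<bar>f :: 'a fls\<bar> = (if f < 0 then - f else f)"

definition sgn_fls :: "'a fls \<Rightarrow> 'a fls" where
  "sgn (f :: 'a fls) = (if f = 0 then 0 else if 0 < f then 1 else - 1)"

instance
proof
  let ?pos = "\<lambda>f :: 'a fls. 0 < fls_nth f (fls_subdegree f)"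
  have pos_add: "?pos (f + g)" if f: "?pos f" and g: "?pos g" for f g
  proof -
    define m where "m = min (fls_subdegree f) (fls_subdegree g)"
    have "m = fls_subdegree f \<and> m \<le> fls_subdegree g \<or> m = fls_subdegree g \<and> m \<le> fls_subdegree f"
      unfolding m_def by linarith
    moreover have "0 \<le> fls_nth h m" if "?pos h" "m \<le> fls_subdegree h" for h
      using that by (cases "m = fls_subdegree h") simp_all
    ultimately have p: "0 < fls_nth (f + g) m"
      using f g by (auto intro: add_pos_nonneg add_nonneg_pos)
    have "fls_nth (f + g) k = 0" if "k < m" for k
      using that by (simp add: m_def)
    with p have "fls_subdegree (f + g) = m"
      by (intro fls_subdegree_eqI) auto
    with p show ?thesis by simp
  qed
  have pos_mult: "?pos (f * g)" if f: "?pos f" and g: "?pos g" for f g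
  proof -
    have "f \<noteq> 0" "g \<noteq> 0" using f g by auto
    thus ?thesis using f g by simp
  qed
  have not_both: False if f: "?pos f" and g: "?pos (- f)" for f
    using f g by simp
  have trichotomy: "f = 0 \<or> ?pos f \<or> ?pos (- f)" for f
    using linorder_less_linear[of "fls_nth f (fls_subdegree f)" 0] by (auto simp: nth_fls_subdegree_zero_iff)
  fix f g h :: "'a fls"
  show "f < g \<longleftrightarrow> f \<le> g \<and> \<not> g \<le> f"
    using not_both[of "g - f"] by (auto simp: less_eq_fls_def less_fls_def)
  show "f \<le> f" by (simp add: less_eq_fls_def)
  show "f \<le> h" if "f \<le> g" "g \<le> h"
    using that pos_add[of "g - f" "h - g"] by (auto simp: less_eq_fls_def less_fls_def)
  show "f = g" if "f \<le> g" "g \<le> f"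
    using that not_both[of "g - f"] by (auto simp: less_eq_fls_def less_fls_def)
  show "f \<le> g \<or> g \<le> f"
    using trichotomy[of "g - f"] by (auto simp: less_eq_fls_def less_fls_def)
  show "h + f \<le> h + g" if "f \<le> g"
    using that by (auto simp: less_eq_fls_def less_fls_def)
  show "h * f < h * g" if "f < g" "0 < h"
    using that pos_mult[of h "g - f"] by (simp add: less_fls_def right_diff_distrib)
  show "\<bar>f\<bar> = (if f < 0 then - f else f)" by (rule abs_fls_def)
  show "sgn f = (if f = 0 then 0 else if 0 < f then 1 else - 1)" by (rule sgn_fls_def)
qed

end

definition is_max_on :: "'b set \<Rightarrow> ('b \<Rightarrow> 'a::linorder) \<Rightarrow> 'a \<Rightarrow> bool" where
  "is_max_on A f m \<longleftrightarrow> m \<in> f ` A \<and> (\<forall>z\<in>A. f z \<le> m)"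

definition is_min_on :: "'b set \<Rightarrow> ('b \<Rightarrow> 'a::linorder) \<Rightarrow> 'a \<Rightarrow> bool" where
  "is_min_on A f m \<longleftrightarrow> m \<in> f ` A \<and> (\<forall>z\<in>A. m \<le> f z)"


section \<open>Flow states and spatial derivatives\<close>

text \<open>\<open>'a = real fls\<close> for states of the scheme, \<open>'a = real\<close> for their coefficients.\<close>

record 'a flow =
  rho :: "real \<times> real \<Rightarrow> 'a"
  velx :: "real \<times> real \<Rightarrow> 'a"
  vely :: "real \<times> real \<Rightarrow> 'a"
  prs :: "real \<times> real \<Rightarrow> 'a"

definition dx :: "(real \<times> real \<Rightarrow> real) \<Rightarrow> real \<times> real \<Rightarrow> real" where
  "dx f z = deriv (\<lambda>s. f (s, snd z)) (fst z)"

definition dy :: "(real \<times> real \<Rightarrow> real) \<Rightarrow> real \<times> real \<Rightarrow> real" where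
  "dy f z = deriv (\<lambda>s. f (fst z, s)) (snd z)"

definition coef :: "(real \<times> real \<Rightarrow> real fls) \<Rightarrow> int \<Rightarrow> real \<times> real \<Rightarrow> real" where
  "coef f k z = fls_nth (f z) k"

text \<open>
  Spatial derivatives of a series are taken coefficientwise; \<open>Abs_fls\<close> is meaningful for
  the fields below, whose orders in \<open>\<epsilon>\<close> are bounded below uniformly in space.
\<close>

definition Dx :: "(real \<times> real \<Rightarrow> real fls) \<Rightarrow> real \<times> real \<Rightarrow> real fls" where
  "Dx f z = Abs_fls (\<lambda>k. dx (coef f k) z)"

definition Dy :: "(real \<times> real \<Rightarrow> real fls) \<Rightarrow> real \<times> real \<Rightarrow> real fls" where
  "Dy f z = Abs_fls (\<lambda>k. dy (coef f k) z)"

definition regular_field :: "(real \<times> real) set \<Rightarrow> (real \<times> real \<Rightarrow> real fls) \<Rightarrow> bool" where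
  "regular_field \<Omega> f \<longleftrightarrow>
     (\<exists>N. \<forall>k<N. \<forall>z\<in>closure \<Omega>. coef f k z = 0) \<and>
     (\<forall>k. continuous_on (closure \<Omega>) (coef f k) \<and> coef f k differentiable_on \<Omega>)"

definition regular_flow :: "(real \<times> real) set \<Rightarrow> real fls flow \<Rightarrow> bool" where
  "regular_flow \<Omega> S \<longleftrightarrow> regular_field \<Omega> (rho S) \<and> regular_field \<Omega> (velx S) \<and>
     regular_field \<Omega> (vely S) \<and> regular_field \<Omega> (prs S)"

definition positive_density :: "(real \<times> real) set \<Rightarrow> real fls flow \<Rightarrow> bool" where
  "positive_density \<Omega> S \<longleftrightarrow> (\<forall>z\<in>closure \<Omega>. 0 < coef (rho S) 0 z)"

definition Div :: "(real \<times> real \<Rightarrow> real fls) \<Rightarrow> (real \<times> real \<Rightarrow> real fls)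
    \<Rightarrow> real \<times> real \<Rightarrow> real fls" where
  "Div f g z = Dx f z + Dy g z"

text \<open>\<open>Adv S f\<close> is \<open>u \<cdot> \<nabla>f\<close>, and \<open>Mass_flux_div S\<close> is \<open>\<nabla> \<cdot> (\<rho>u)\<close>.\<close>

definition Adv :: "real fls flow \<Rightarrow> (real \<times> real \<Rightarrow> real fls) \<Rightarrow> real \<times> real \<Rightarrow> real fls" where
  "Adv S f z = velx S z * Dx f z + vely S z * Dy f z"

definition Mass_flux_div :: "real fls flow \<Rightarrow> real \<times> real \<Rightarrow> real fls" where
  "Mass_flux_div S = Div (\<lambda>z. rho S z * velx S z) (\<lambda>z. rho S z * vely S z)"

definition DivU :: "real fls flow \<Rightarrow> real \<times> real \<Rightarrow> real fls" where
  "DivU S = Div (velx S) (vely S)"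


section \<open>Well-prepared expansions and boundary condition\<close>

text \<open>
  An expansion in nonnegative powers of \<open>\<epsilon>\<close> with the low-Mach-number scaling: \<open>p\<^sup>(\<^sup>0\<^sup>)\<close> and
  \<open>p\<^sup>(\<^sup>1\<^sup>)\<close> are the given constants, \<open>u\<^sup>(\<^sup>0\<^sup>)\<close> and \<open>u\<^sup>(\<^sup>1\<^sup>)\<close> are divergence free.
\<close>

definition well_prepared :: "(real \<times> real) set \<Rightarrow> real \<Rightarrow> real \<Rightarrow> real fls flow \<Rightarrow> bool" where
  "well_prepared \<Omega> p0 p1 S \<longleftrightarrow>
     (\<forall>z\<in>closure \<Omega>. \<forall>k<0. coef (rho S) k z = 0 \<and> coef (velx S) k z = 0 \<and>
        coef (vely S) k z = 0 \<and> coef (prs S) k z = 0) \<and>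
     (\<forall>z\<in>closure \<Omega>. coef (prs S) 0 z = p0 \<and> coef (prs S) 1 z = p1) \<and>
     (\<forall>z\<in>\<Omega>. dx (coef (velx S) 0) z + dy (coef (vely S) 0) z = 0) \<and>
     (\<forall>z\<in>\<Omega>. dx (coef (velx S) 1) z + dy (coef (vely S) 1) z = 0)"

text \<open>\<open>pb k\<close> for \<open>k \<ge> 2\<close> is the boundary function \<open>p\<^sub>k\<close> at the time level of \<open>S\<close>.\<close>

definition dirichlet_pressure :: "(real \<times> real) set \<Rightarrow> real \<Rightarrow> real \<Rightarrow> real fls flow \<Rightarrow> bool" where
  "dirichlet_pressure \<Omega> p0 p1 S \<longleftrightarrow>
     (\<exists>pb :: nat \<Rightarrow> real \<times> real \<Rightarrow> real.
        (\<forall>k\<ge>2. bounded (pb k ` frontier \<Omega>)) \<and>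
        (\<forall>z\<in>frontier \<Omega>. prs S z =
           fps_to_fls (Abs_fps (\<lambda>k. if k = 0 then p0 else if k = 1 then p1 else pb k z))))"


section \<open>The limit equations and consistency\<close>

text \<open>
  A state \<open>y :: real flow\<close> of the limit equations holds \<open>\<rho>\<^sup>(\<^sup>0\<^sup>)\<close>, \<open>u\<^sup>(\<^sup>0\<^sup>)\<close> and, in \<open>prs\<close>, the
  second-order pressure \<open>p\<^sup>(\<^sup>2\<^sup>)\<close>.
\<close>

definition limit_state :: "real fls flow \<Rightarrow> real flow" where
  "limit_state S = \<lparr>rho = coef (rho S) 0, velx = coef (velx S) 0, vely = coef (vely S) 0,
     prs = coef (prs S) 2\<rparr>"

definition evolved :: "real flow \<Rightarrow> real \<times> real \<Rightarrow> real \<times> real \<times> real" where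
  "evolved y z = (rho y z, velx y z, vely y z)"

definition adv :: "real flow \<Rightarrow> (real \<times> real \<Rightarrow> real) \<Rightarrow> real \<times> real \<Rightarrow> real" where
  "adv y f z = velx y z * dx f z + vely y z * dy f z"

definition mass_flux_div :: "real flow \<Rightarrow> real \<times> real \<Rightarrow> real" where
  "mass_flux_div y z = dx (\<lambda>z. rho y z * velx y z) z + dy (\<lambda>z. rho y z * vely y z) z"

text \<open>
  Classical solutions, on the time interval \<open>(a, b)\<close>, of
  \<open>\<rho>\<^sub>t + \<nabla> \<cdot> (\<rho>u) = 0\<close>, \<open>u\<^sub>t + (u \<cdot> \<nabla>)u + (1/\<rho>) \<nabla>p\<^sup>(\<^sup>2\<^sup>) = 0\<close>, \<open>\<nabla> \<cdot> u = 0\<close>.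
\<close>

definition limit_solution ::
  "(real \<times> real) set \<Rightarrow> real \<Rightarrow> real \<Rightarrow> (real \<Rightarrow> real flow) \<Rightarrow> bool" where
  "limit_solution \<Omega> a b y \<longleftrightarrow>
     (\<forall>w \<in> {\<lambda>t. rho (y t), \<lambda>t. velx (y t), \<lambda>t. vely (y t), \<lambda>t. prs (y t)}.
        continuous_on ({a<..<b} \<times> closure \<Omega>) (\<lambda>(t, z). w t z) \<and>
        (\<forall>t\<in>{a<..<b}. w t differentiable_on \<Omega>) \<and>
        continuous_on ({a<..<b} \<times> \<Omega>) (\<lambda>(t, z). dx (w t) z) \<and>
        continuous_on ({a<..<b} \<times> \<Omega>) (\<lambda>(t, z). dy (w t) z)) \<and>
     (\<forall>t\<in>{a<..<b}. \<forall>z\<in>closure \<Omega>. 0 < rho (y t) z) \<and>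
     (\<forall>t\<in>{a<..<b}. \<forall>z\<in>\<Omega>.
        ((\<lambda>s. rho (y s) z) has_real_derivative - mass_flux_div (y t) z) (at t) \<and>
        ((\<lambda>s. velx (y s) z) has_real_derivative
           - adv (y t) (velx (y t)) z - 1 / rho (y t) z * dx (prs (y t)) z) (at t) \<and>
        ((\<lambda>s. vely (y s) z) has_real_derivative
           - adv (y t) (vely (y t)) z - 1 / rho (y t) z * dy (prs (y t)) z) (at t) \<and>
        dx (velx (y t)) z + dy (vely (y t)) z = 0)"

text \<open>
  A two-stage discretization of the limit equations is given by increments \<open>\<Phi>1\<close>, \<open>\<Phi>2\<close>:
  \<open>y\<^sup>* = y\<^sup>n + \<Delta>t \<Phi>1(y\<^sup>n, y\<^sup>*)\<close> and \<open>y\<^sup>n\<^sup>+\<^sup>1 = y\<^sup>n + \<Delta>t \<Phi>2(y\<^sup>n, y\<^sup>*, y\<^sup>n\<^sup>+\<^sup>1)\<close>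
  for the evolved variables, together with the divergence constraint at both stages.
  It is consistent if the truncation error of each stage, divided by the time step, tends
  to zero when a classical solution is inserted; both stages approximate the solution at
  \<open>t\<^sup>n\<^sup>+\<^sup>1\<close>.  The constraints of \<open>well_prepared\<close> contain no time derivative and are to
  hold exactly.
\<close>

type_synonym increment1 = "real flow \<Rightarrow> real flow \<Rightarrow> real \<times> real \<Rightarrow> real \<times> real \<times> real"
type_synonym increment2 =
  "real flow \<Rightarrow> real flow \<Rightarrow> real flow \<Rightarrow> real \<times> real \<Rightarrow> real \<times> real \<times> real"

definition consistent_increments ::
  "(real \<times> real) set \<Rightarrow> increment1 \<Rightarrow> increment2 \<Rightarrow> bool" where
  "consistent_increments \<Omega> \<Phi>1 \<Phi>2 \<longleftrightarrow>
     (\<forall>a b y. limit_solution \<Omega> a b y \<longrightarrow> (\<forall>t\<in>{a<..<b}. \<forall>z\<in>\<Omega>.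
        ((\<lambda>h. (evolved (y (t + h)) z - evolved (y t) z) /\<^sub>R h
              - \<Phi>1 (y t) (y (t + h)) z) \<longlongrightarrow> 0) (at_right 0) \<and>
        ((\<lambda>h. (evolved (y (t + h)) z - evolved (y t) z) /\<^sub>R h
              - \<Phi>2 (y t) (y (t + h)) (y (t + h)) z) \<longlongrightarrow> 0) (at_right 0)))"


section \<open>Asymptotic preserving discretizations\<close>

text \<open>
  A discretization is a relation \<open>scheme dt Sn Ss Sn'\<close> between the time step, the given state,
  the intermediate state and the new state.  The new states are a priori formal Laurent
  series; admitting an asymptotic expansion means that no negative powers of \<open>\<epsilon>\<close> occur.  The
  consistent discretization obtained as \<open>\<epsilon> \<rightarrow> 0\<close> is named explicitly by its increments: hiding
  them behind an existential quantifier would make the requirement void.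
\<close>

definition asymptotic_preserving ::
  "(real \<times> real) set \<Rightarrow> real \<Rightarrow> real \<Rightarrow>
   (real fls \<Rightarrow> real fls flow \<Rightarrow> real fls flow \<Rightarrow> real fls flow \<Rightarrow> bool) \<Rightarrow>
   increment1 \<Rightarrow> increment2 \<Rightarrow> bool" where
  "asymptotic_preserving \<Omega> p0 p1 scheme \<Phi>1 \<Phi>2 \<longleftrightarrow>
     consistent_increments \<Omega> \<Phi>1 \<Phi>2 \<and>
     (\<forall>dt Sn Ss Sn'.
        regular_flow \<Omega> Sn \<and> regular_flow \<Omega> Ss \<and> regular_flow \<Omega> Sn' \<and>
        positive_density \<Omega> Sn \<and> positive_density \<Omega> Ss \<and>
        well_prepared \<Omega> p0 p1 Sn \<and>
        dirichlet_pressure \<Omega> p0 p1 Sn \<and> dirichlet_pressure \<Omega> p0 p1 Ss \<and>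
        dirichlet_pressure \<Omega> p0 p1 Sn' \<and>
        scheme dt Sn Ss Sn' \<longrightarrow>
          well_prepared \<Omega> p0 p1 Ss \<and> well_prepared \<Omega> p0 p1 Sn' \<and>
          (\<forall>k<0. fls_nth dt k = 0) \<and> 0 < fls_nth dt 0 \<and>
          (\<forall>z\<in>\<Omega>.
             evolved (limit_state Ss) z = evolved (limit_state Sn) z
               + fls_nth dt 0 *\<^sub>R \<Phi>1 (limit_state Sn) (limit_state Ss) z \<and>
             evolved (limit_state Sn') z = evolved (limit_state Sn) z
               + fls_nth dt 0 *\<^sub>R \<Phi>2 (limit_state Sn) (limit_state Ss) (limit_state Sn') z))"


section \<open>The SI-DeC scheme\<close>

abbreviation eps :: "real fls" where "eps \<equiv> fls_X"

text \<open>
  The square root in \<open>c\<close> may produce odd powers of \<open>\<surd>\<epsilon>\<close>.  The time-step formula is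
  therefore evaluated in series in \<open>\<surd>\<epsilon>\<close> (also of type \<open>real fls\<close>), into which series in
  \<open>\<epsilon>\<close> embed by \<open>fls_compose_power _ 2\<close>; the time step itself is a series in \<open>\<epsilon>\<close>.  The last
  conjunct excludes a fluid at rest in the limit \<open>\<epsilon> \<rightarrow> 0\<close>, for which the formula gives no
  finite limiting time step.
\<close>

definition cfl_time_step :: "(real \<times> real) set \<Rightarrow> real \<Rightarrow> real \<Rightarrow> real \<Rightarrow> real \<Rightarrow>
    real fls flow \<Rightarrow> real fls \<Rightarrow> real fls \<Rightarrow> real fls \<Rightarrow> bool" where
  "cfl_time_step \<Omega> \<gamma> K \<Delta>x \<Delta>y S rmax pmin dt \<longleftrightarrow>
     (\<exists>c a b.
        (\<forall>z\<in>closure \<Omega>. 0 \<le> c z \<and>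
           (c z)\<^sup>2 = fls_compose_power
             (1 / eps\<^sup>2 * (fls_const \<gamma> * ((rmax - rho S z) * (prs S z - pmin) / (rho S z * rmax)))) 2) \<and>
        is_max_on (closure \<Omega>) (\<lambda>z. \<bar>fls_compose_power (velx S z) 2\<bar> + c z) a \<and>
        is_max_on (closure \<Omega>) (\<lambda>z. \<bar>fls_compose_power (vely S z) 2\<bar> + c z) b \<and>
        a \<noteq> 0 \<and> b \<noteq> 0 \<and>
        fls_compose_power dt 2 = fls_const K * min (fls_const \<Delta>x / a) (fls_const \<Delta>y / b) \<and>
        (fls_nth a 0 \<noteq> 0 \<or> fls_nth b 0 \<noteq> 0))"

definition si_dec_stage1 :: "(real \<times> real) set \<Rightarrow> real \<Rightarrow> real fls \<Rightarrow> real fls \<Rightarrow> real fls \<Rightarrow>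
    real fls flow \<Rightarrow> real fls flow \<Rightarrow> bool" where
  "si_dec_stage1 \<Omega> \<gamma> dt rmax pmin S Ss \<longleftrightarrow> (\<forall>z\<in>\<Omega>.
     rho Ss z = rho S z - dt * Mass_flux_div S z \<and>
     velx Ss z = velx S z
       - dt * (Adv S (velx S) z + (rmax - rho S z) / (eps\<^sup>2 * rho S z * rmax) * Dx (prs S) z)
       - dt / (eps\<^sup>2 * rmax) * Dx (prs Ss) z \<and>
     vely Ss z = vely S z
       - dt * (Adv S (vely S) z + (rmax - rho S z) / (eps\<^sup>2 * rho S z * rmax) * Dy (prs S) z)
       - dt / (eps\<^sup>2 * rmax) * Dy (prs Ss) z \<and>
     prs Ss z = prs S z
       - dt * (Adv S (prs S) z + fls_const \<gamma> * (prs S z - pmin) * DivU S z)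
       - dt * fls_const \<gamma> * pmin * DivU Ss z)"

definition si_dec_stage2 :: "(real \<times> real) set \<Rightarrow> real \<Rightarrow> real fls \<Rightarrow> real fls \<Rightarrow> real fls \<Rightarrow>
    real fls \<Rightarrow> real fls \<Rightarrow> real fls flow \<Rightarrow> real fls flow \<Rightarrow> real fls flow \<Rightarrow> bool" where
  "si_dec_stage2 \<Omega> \<gamma> dt rmax pmin rmaxs pmins S Ss S' \<longleftrightarrow> (\<forall>z\<in>\<Omega>.
     rho S' z = rho S z - dt / 2 * (Mass_flux_div S z + Mass_flux_div Ss z) \<and>
     velx S' z = velx S z
       - dt / 2 * (Adv S (velx S) z + Adv Ss (velx Ss) z
           + (rmax - rho S z) / (eps\<^sup>2 * rho S z * rmax) * Dx (prs S) z
           + (rmaxs - rho Ss z) / (eps\<^sup>2 * rho Ss z * rmaxs) * Dx (prs Ss) z)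
       - dt / (2 * eps\<^sup>2) * (Dx (prs S) z / rmax - Dx (prs Ss) z / rmaxs)
       - dt / (eps\<^sup>2 * rmaxs) * Dx (prs S') z \<and>
     vely S' z = vely S z
       - dt / 2 * (Adv S (vely S) z + Adv Ss (vely Ss) z
           + (rmax - rho S z) / (eps\<^sup>2 * rho S z * rmax) * Dy (prs S) z
           + (rmaxs - rho Ss z) / (eps\<^sup>2 * rho Ss z * rmaxs) * Dy (prs Ss) z)
       - dt / (2 * eps\<^sup>2) * (Dy (prs S) z / rmax - Dy (prs Ss) z / rmaxs)
       - dt / (eps\<^sup>2 * rmaxs) * Dy (prs S') z \<and>
     prs S' z = prs S z
       - dt / 2 * (Adv S (prs S) z + Adv Ss (prs Ss) z
           + fls_const \<gamma> * (prs S z - pmin) * DivU S z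
           + fls_const \<gamma> * (prs Ss z - pmins) * DivU Ss z)
       - dt / 2 * fls_const \<gamma> * (pmin * DivU S z - pmins * DivU Ss z)
       - dt * fls_const \<gamma> * pmins * DivU S' z)"

text \<open>
  The equations hold in the open set \<open>\<Omega>\<close>; maxima and minima over the domain are taken over
  its closure, where they are attained.
\<close>

definition si_dec :: "(real \<times> real) set \<Rightarrow> real \<Rightarrow> real \<Rightarrow> real \<Rightarrow> real \<Rightarrow>
    real fls \<Rightarrow> real fls flow \<Rightarrow> real fls flow \<Rightarrow> real fls flow \<Rightarrow> bool" where
  "si_dec \<Omega> \<gamma> K \<Delta>x \<Delta>y dt S Ss S' \<longleftrightarrow>
     (\<exists>rmax pmin rmaxs pmins.
        is_max_on (closure \<Omega>) (rho S) rmax \<and> is_min_on (closure \<Omega>) (prs S) pmin \<and>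
        is_max_on (closure \<Omega>) (rho Ss) rmaxs \<and> is_min_on (closure \<Omega>) (prs Ss) pmins \<and>
        cfl_time_step \<Omega> \<gamma> K \<Delta>x \<Delta>y S rmax pmin dt \<and>
        si_dec_stage1 \<Omega> \<gamma> dt rmax pmin S Ss \<and>
        si_dec_stage2 \<Omega> \<gamma> dt rmax pmin rmaxs pmins S Ss S')"


section \<open>The limit of the SI-DeC scheme\<close>

definition max_density :: "(real \<times> real) set \<Rightarrow> real flow \<Rightarrow> real" where
  "max_density \<Omega> y = (SUP z\<in>closure \<Omega>. rho y z)"

definition limit_increment1 :: "(real \<times> real) set \<Rightarrow> increment1" where
  "limit_increment1 \<Omega> y ys z = (let r = max_density \<Omega> y in
     (- mass_flux_div y z,
      - (adv y (velx y) z + (r - rho y z) / (rho y z * r) * dx (prs y) z) - 1 / r * dx (prs ys) z,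
      - (adv y (vely y) z + (r - rho y z) / (rho y z * r) * dy (prs y) z) - 1 / r * dy (prs ys) z))"

definition limit_increment2 :: "(real \<times> real) set \<Rightarrow> increment2" where
  "limit_increment2 \<Omega> y ys y' z = (let r = max_density \<Omega> y; rs = max_density \<Omega> ys in
     (- (mass_flux_div y z + mass_flux_div ys z) / 2,
      - (adv y (velx y) z + adv ys (velx ys) z
          + (r - rho y z) / (rho y z * r) * dx (prs y) z
          + (rs - rho ys z) / (rho ys z * rs) * dx (prs ys) z) / 2
        - (dx (prs y) z / r - dx (prs ys) z / rs) / 2 - 1 / rs * dx (prs y') z,
      - (adv y (vely y) z + adv ys (vely ys) z
          + (r - rho y z) / (rho y z * r) * dy (prs y) z
          + (rs - rho ys z) / (rho ys z * rs) * dy (prs ys) z) / 2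
        - (dy (prs y) z / r - dy (prs ys) z / rs) / 2 - 1 / rs * dy (prs y') z))"

end

theory Submission
  imports Defs
begin

text \<open>
  The danger for an asymptotic preserving scheme is the factor \<open>\<epsilon>\<^sup>-\<^sup>2\<close>, which could produce negative powers
  of \<open>\<epsilon>\<close> or spoil the constancy of the low-order pressures.  Three facts exclude this.

  The time step is of order exactly one.  For well-prepared data the pressure varies in space only from order
  \<open>\<epsilon>\<^sup>2\<close> on, which compensates the factor \<open>\<epsilon>\<^sup>-\<^sup>2\<close> in the sound speed of the splitting; the wave speeds are
  therefore finite, and one of them is required to have a nonzero limit (\<open>cfl_time_step_order_zero\<close>).

  In each stage the explicit terms are of order zero for the same reason, and velocity and pressure are
  coupled by \<open>u = F - C \<nabla>p\<close> and \<open>p = B - Q \<nabla> \<cdot> u\<close> with \<open>C\<close> of order \<open>\<epsilon>\<^sup>-\<^sup>2\<close>.  Order by order, every pressure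
  coefficient below order two solves Laplace's equation with constant Dirichlet values, so it is
  constant by the maximum principle, and the velocity coefficients of negative order, which are
  multiples of its gradient, vanish.  The pressure equation at orders zero and one then yields the
  divergence constraints (\<open>harmonic_const_boundary\<close>, \<open>implicit_pressure_velocity_expansion\<close>).  So both new
  states are well prepared, and comparing coefficients of order zero gives the limit scheme
  (\<open>si_dec_stage1_limit\<close>, \<open>si_dec_stage2_limit\<close>).

  The limit scheme is consistent: the explicit coefficient \<open>(\<rho>\<^sub>m\<^sub>a\<^sub>x - \<rho>)/(\<rho> \<rho>\<^sub>m\<^sub>a\<^sub>x)\<close> and the implicit coefficient
  \<open>1/\<rho>\<^sub>m\<^sub>a\<^sub>x\<close> of the second-order pressure gradient add up to \<open>1/\<rho>\<close>, and all quantities, the density maximum included,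
  are continuous in time along a classical solution (\<open>limit_increments_consistent\<close>).
\<close>

section \<open>Leading terms of formal Laurent series\<close>

text \<open>
  \<open>f = c \<epsilon>\<^sup>m + O(\<epsilon>\<^sup>m\<^sup>+\<^sup>1)\<close>.  The coefficient \<open>c\<close> is allowed to be zero, so that the predicate also
  carries mere bounds on the order and is preserved by sums in which leading terms cancel.  Every
  term of the scheme is then estimated by composing the rules for the arithmetic operations.
\<close>

definition leading :: "'a::zero fls \<Rightarrow> int \<Rightarrow> 'a \<Rightarrow> bool" where
  "leading f m c \<longleftrightarrow> (\<forall>k<m. fls_nth f k = 0) \<and> fls_nth f m = c"

lemma leading_nth: "leading f m c \<Longrightarrow> fls_nth f m = c"
  by (simp add: leading_def)

lemma leading_nth_below: "leading f m c \<Longrightarrow> k < m \<Longrightarrow> fls_nth f k = 0"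
  by (simp add: leading_def)

lemma leading_weaken: "leading f m c \<Longrightarrow> k < m \<Longrightarrow> leading f k 0"
  by (simp add: leading_def)

lemma leading_add:
  fixes f g :: "'a::monoid_add fls"
  shows "leading f m c \<Longrightarrow> leading g m d \<Longrightarrow> leading (f + g) m (c + d)"
  by (simp add: leading_def)

lemma leading_diff:
  fixes f g :: "'a::group_add fls"
  shows "leading f m c \<Longrightarrow> leading g m d \<Longrightarrow> leading (f - g) m (c - d)"
  by (simp add: leading_def)

lemma leading_const: "leading (fls_const c) 0 c"
  by (simp add: leading_def)

lemma leading_numeral: "leading (numeral n :: real fls) 0 (numeral n)"
  by (simp add: leading_def)

lemma leading_eps_squared: "leading (eps\<^sup>2) 2 1"
  by (simp add: leading_def)

lemma leading_subdegree: "leading f m c \<Longrightarrow> f \<noteq> 0 \<Longrightarrow> m \<le> fls_subdegree f"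
  by (rule fls_subdegree_geI) (auto simp: leading_def)

lemma leading_subdegree_eq: "leading f m c \<Longrightarrow> c \<noteq> 0 \<Longrightarrow> fls_subdegree f = m"
  by (rule fls_subdegree_eqI) (auto simp: leading_def)

lemma leading_mult:
  fixes f g :: "'a::field fls"
  assumes f: "leading f m c" and g: "leading g n d"
  shows "leading (f * g) (m + n) (c * d)"
proof (cases "f = 0 \<or> g = 0")
  case True
  with f g show ?thesis by (auto simp: leading_def)
next
  case False
  note le = leading_subdegree[OF f] leading_subdegree[OF g]
  \<comment> \<open>If a coefficient vanishes, the order of the product is strictly above \<open>m + n\<close>.\<close>
  have below: "fls_nth (f * g) k = 0" if "k < fls_subdegree f + fls_subdegree g" for k
    using that by (rule fls_times_nth_eq0)
  have "fls_nth (f * g) (m + n) = c * d"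
  proof (cases "c = 0 \<or> d = 0")
    case True
    hence "m < fls_subdegree f \<or> n < fls_subdegree g"
      using le False f g by (metis leading_nth nth_fls_subdegree_nonzero order_le_less)
    thus ?thesis using True below[of "m + n"] le False by auto
  next
    case nz: False
    hence "fls_subdegree f = m" "fls_subdegree g = n"
      using f g by (simp_all add: leading_subdegree_eq)
    thus ?thesis using f g fls_times_base[of f g] by (simp add: leading_def)
  qed
  thus ?thesis using below le False by (auto simp: leading_def)
qed

lemma leading_divide:
  fixes f g :: "'a::field fls"
  assumes f: "leading f m c" and g: "leading g n d" and d: "d \<noteq> 0"
  shows "leading (f / g) (m - n) (c / d)"
proof -
  have s: "fls_subdegree g = n" by (rule leading_subdegree_eq[OF g d])
  have "leading (inverse g) (- n) (inverse d)"
    using fls_inverse_subdegree[of g] fls_inverse_subdegree_base[of g] s leading_nth[OF g]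
    by (auto simp: leading_def)
  from leading_mult[OF f this] show ?thesis by (simp add: divide_inverse)
qed

lemma leading_mult_unit:
  fixes f g :: "'a::field fls"
  shows "leading f 0 c \<Longrightarrow> leading g m d \<Longrightarrow> leading (f * g) m (c * d)"
  using leading_mult[of f 0 c g m d] by simp

lemma leading_divide_unit:
  fixes f g :: "'a::field fls"
  shows "leading f m c \<Longrightarrow> leading g 0 d \<Longrightarrow> d \<noteq> 0 \<Longrightarrow> leading (f / g) m (c / d)"
  using leading_divide[of f m c g 0 d] by simp

section \<open>The order of the Laurent field and the size of the time step\<close>

lemma fls_pos_iff: "0 < (f :: real fls) \<longleftrightarrow> 0 < fls_nth f (fls_subdegree f)"
  by (simp add: less_fls_def)

text \<open>
  Two series are compared at the first power of \<open>\<epsilon>\<close> at which they differ, so passing to the coefficient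
  at a common lower order is monotone.
\<close>

lemma leading_coefficient_mono:
  fixes f g :: "real fls"
  assumes "f \<le> g" "leading f m c" "leading g m d"
  shows "c \<le> d"
proof (rule ccontr)
  assume "\<not> c \<le> d"
  have "leading (g - f) m (d - c)" by (intro leading_diff assms)
  moreover from this \<open>\<not> c \<le> d\<close> have "fls_subdegree (g - f) = m"
    by (intro leading_subdegree_eq) auto
  ultimately have "\<not> f < g" "f \<noteq> g" using \<open>\<not> c \<le> d\<close> by (auto simp: less_fls_def leading_def)
  with \<open>f \<le> g\<close> show False by (simp add: less_eq_fls_def)
qed

text \<open>
  A positive series of strictly higher order is infinitesimal compared with one of lower order, hence smaller.
\<close>

lemma subdegree_antimono:
  fixes f g :: "real fls"
  assumes "0 < f" "f \<le> g"
  shows "fls_subdegree g \<le> fls_subdegree f"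
proof (rule ccontr)
  let ?m = "fls_subdegree f"
  assume "\<not> ?thesis"
  hence "leading g ?m 0" by (simp add: leading_def)
  moreover have "leading f ?m (fls_nth f ?m)" by (simp add: leading_def)
  ultimately have "fls_nth f ?m \<le> 0" by (intro leading_coefficient_mono[OF assms(2)])
  with assms(1) show False by (simp add: fls_pos_iff)
qed

lemma leading_sqrt:
  fixes f :: "'a::field fls"
  assumes "leading (f\<^sup>2) 0 c"
  shows "leading f 0 (fls_nth f 0)"
proof (cases "f = 0")
  case False
  have "fls_subdegree (f\<^sup>2) = 2 * fls_subdegree f" by (simp add: fls_subdegree_pow)
  with leading_subdegree[OF assms] False show ?thesis by (auto simp: leading_def)
qed (simp add: leading_def)

lemma fls_nth_compose_square: "fls_nth (fls_compose_power f 2) (2 * k) = fls_nth f k"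
  by (simp add: fls_nth_compose_power)

lemma leading_compose_square: "leading f 0 c \<Longrightarrow> leading (fls_compose_power f 2) 0 c"
  by (auto simp: leading_def fls_nth_compose_power)

lemma leading_abs: "leading (f :: real fls) 0 c \<Longrightarrow> leading \<bar>f\<bar> 0 (fls_nth \<bar>f\<bar> 0)"
  by (simp add: abs_fls_def leading_def)

text \<open>
  The abstract form of the time-step formula, with \<open>a\<close> and \<open>b\<close> the two maximal wave speeds.  Both
  speeds are finite, so neither quotient is infinitesimal; one of them is not infinitesimal, so its
  quotient is finite and bounds the minimum.  The other quotient may be infinitely large.
\<close>

lemma min_quotient_order_zero:
  fixes a b :: "real fls"
  assumes pos: "0 < a" "0 < b" "0 < r" "0 < s" "0 < K"
    and a: "leading a 0 a0" and b: "leading b 0 b0" and nz: "a0 \<noteq> 0 \<or> b0 \<noteq> 0"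
  defines "q \<equiv> fls_const K * min (fls_const r / a) (fls_const s / b)"
  shows "leading q 0 (fls_nth q 0) \<and> 0 < fls_nth q 0"
proof -
  have const_pos: "0 < (fls_const c :: real fls)" if "0 < c" for c :: real
    using that by (simp add: fls_pos_iff)
  define m where "m = min (fls_const r / a) (fls_const s / b)"
  have mpos: "0 < m" unfolding m_def using pos const_pos by simp
  have sa: "fls_subdegree (fls_const r / a) = - fls_subdegree a"
    and sb: "fls_subdegree (fls_const s / b) = - fls_subdegree b"
    using pos by (subst fls_divide_subdegree; force)+
  have "0 \<le> fls_subdegree a" "0 \<le> fls_subdegree b"
    using leading_subdegree[OF a] leading_subdegree[OF b] pos by auto
  hence up: "fls_subdegree m \<le> 0"
    unfolding m_def min_def using sa sb by auto
  have "fls_subdegree a = 0 \<or> fls_subdegree b = 0"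
    using nz leading_subdegree_eq[OF a] leading_subdegree_eq[OF b] by blast
  hence "0 \<le> fls_subdegree m"
    using subdegree_antimono[OF mpos, of "fls_const r / a"] subdegree_antimono[OF mpos, of "fls_const s / b"]
      sa sb unfolding m_def by auto
  with up have m0: "fls_subdegree m = 0" by simp
  with mpos have p0: "0 < fls_nth m 0" by (simp add: fls_pos_iff)
  have "leading m 0 (fls_nth m 0)" using m0 by (simp add: leading_def)
  from leading_mult[OF leading_const[of K] this]
  have "leading q 0 (K * fls_nth m 0)" by (simp add: q_def m_def)
  thus ?thesis using p0 pos by (simp add: leading_def)
qed

section \<open>Laplace's equation with constant boundary values\<close>

lemma second_derivative_nonpos_at_max:
  fixes g :: "real \<Rightarrow> real"
  assumes d: "0 < d"
    and g: "\<And>s. \<bar>s - x\<bar> < d \<Longrightarrow> (g has_real_derivative g' s) (at s)"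
    and g': "(g' has_real_derivative l) (at x)"
    and max: "\<And>s. \<bar>s - x\<bar> < d \<Longrightarrow> g s \<le> g x"
  shows "l \<le> 0"
proof (rule ccontr)
  assume "\<not> l \<le> 0"
  have "g' x = 0"
    by (rule DERIV_local_max[OF g d]) (use max d in \<open>auto simp: abs_minus_commute\<close>)
  obtain e where e: "0 < e" "\<And>h. 0 < h \<Longrightarrow> h < e \<Longrightarrow> g' x < g' (x + h)"
    using DERIV_pos_inc_right[OF g'] \<open>\<not> l \<le> 0\<close> by auto
  define h where "h = min d e / 2"
  have h: "0 < h" "h < d" "h < e" using d e by (auto simp: h_def)
  obtain s where s: "x < s" "s < x + h" "g (x + h) - g x = (x + h - x) * g' s"
    using MVT2[of x "x + h" g g'] g h by fastforce
  have "0 < g' s" using e(2)[of "s - x"] s h \<open>g' x = 0\<close> by simp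
  with s h have "0 < g (x + h) - g x" by simp
  moreover have "g (x + h) \<le> g x" using max[of "x + h"] h by simp
  ultimately show False by simp
qed

lemma open_segment_x:
  fixes \<Omega> :: "(real \<times> real) set"
  assumes "open \<Omega>" "z \<in> \<Omega>"
  obtains d where "0 < d" "\<And>s. \<bar>s - fst z\<bar> < d \<Longrightarrow> (s, snd z) \<in> \<Omega>"
proof -
  from assms obtain d where "0 < d" "ball z d \<subseteq> \<Omega>" by (meson openE)
  moreover have "(s, snd z) \<in> ball z d" if "\<bar>s - fst z\<bar> < d" for s
    using that by (cases z) (simp add: dist_Pair_Pair dist_real_def abs_minus_commute)
  ultimately show thesis using that by blast
qed

lemma open_segment_y:
  fixes \<Omega> :: "(real \<times> real) set"
  assumes "open \<Omega>" "z \<in> \<Omega>"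
  obtains d where "0 < d" "\<And>s. \<bar>s - snd z\<bar> < d \<Longrightarrow> (fst z, s) \<in> \<Omega>"
proof -
  from assms obtain d where "0 < d" "ball z d \<subseteq> \<Omega>" by (meson openE)
  moreover have "(fst z, s) \<in> ball z d" if "\<bar>s - snd z\<bar> < d" for s
    using that by (cases z) (simp add: dist_Pair_Pair dist_real_def abs_minus_commute)
  ultimately show thesis using that by blast
qed

lemma has_dx:
  assumes "f differentiable_on \<Omega>" "open \<Omega>" "(s, y) \<in> \<Omega>"
  shows "((\<lambda>s. f (s, y)) has_real_derivative dx f (s, y)) (at s)"
proof -
  have "f differentiable at (s, y)" using assms by (simp add: differentiable_on_eq_differentiable_at)
  hence "(f \<circ> (\<lambda>s. (s, y))) differentiable at s"
    by (intro differentiable_chain_at) auto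
  hence "(\<lambda>s. f (s, y)) field_differentiable at s"
    by (auto simp: o_def real_differentiable_def field_differentiable_def)
  thus ?thesis by (simp add: dx_def DERIV_deriv_iff_field_differentiable)
qed

lemma has_dy:
  assumes "f differentiable_on \<Omega>" "open \<Omega>" "(x, s) \<in> \<Omega>"
  shows "((\<lambda>s. f (x, s)) has_real_derivative dy f (x, s)) (at s)"
proof -
  have "f differentiable at (x, s)" using assms by (simp add: differentiable_on_eq_differentiable_at)
  hence "(f \<circ> (\<lambda>s. (x, s))) differentiable at s"
    by (intro differentiable_chain_at) auto
  hence "(\<lambda>s. f (x, s)) field_differentiable at s"
    by (auto simp: o_def real_differentiable_def field_differentiable_def)
  thus ?thesis by (simp add: dy_def DERIV_deriv_iff_field_differentiable)
qed

text \<open>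
  Adding \<open>\<delta> x\<^sup>2\<close> makes the Laplacian strictly positive, which is incompatible with an interior maximum:
  there both second partial derivatives of the perturbed function are nonpositive.  That function therefore attains
  its maximum on the boundary, and \<open>\<delta>\<close> can be made small because the domain is bounded.  The
  argument uses only that the first partial derivatives are again differentiable, which is all
  that the coefficients of the scheme provide.
\<close>

lemma harmonic_le_boundary:
  fixes v :: "real \<times> real \<Rightarrow> real"
  assumes \<Omega>: "open \<Omega>" "bounded \<Omega>" and cont: "continuous_on (closure \<Omega>) v"
    and diff: "v differentiable_on \<Omega>" "dx v differentiable_on \<Omega>" "dy v differentiable_on \<Omega>"
    and lap: "\<And>z. z \<in> \<Omega> \<Longrightarrow> dx (dx v) z + dy (dy v) z = 0"
    and bd: "\<And>z. z \<in> frontier \<Omega> \<Longrightarrow> v z \<le> b"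
    and z: "z \<in> closure \<Omega>"
  shows "v z \<le> b"
proof (rule field_le_epsilon)
  fix e :: real assume "0 < e"
  have cpt: "compact (closure \<Omega>)" using \<Omega>(2) by (simp add: compact_closure)
  obtain M where M: "0 < M" "\<And>z. z \<in> closure \<Omega> \<Longrightarrow> norm z \<le> M"
    using compact_imp_bounded[OF cpt] bounded_pos by blast
  \<comment> \<open>The perturbation \<open>\<delta> x\<^sup>2\<close> is then at most \<open>e\<close> on the closed domain.\<close>
  define \<delta> where "\<delta> = e / M\<^sup>2"
  have \<delta>: "0 < \<delta>" using \<open>0 < e\<close> M by (simp add: \<delta>_def)
  define w where "w = (\<lambda>z. v z + \<delta> * (fst z)\<^sup>2)"
  have "continuous_on (closure \<Omega>) w" unfolding w_def by (intro continuous_intros cont)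
  then obtain z0 where z0: "z0 \<in> closure \<Omega>" "\<And>z. z \<in> closure \<Omega> \<Longrightarrow> w z \<le> w z0"
    using continuous_attains_sup[OF cpt, of w] z by (metis empty_iff)
  have "z0 \<notin> \<Omega>"
  proof
    assume in\<Omega>: "z0 \<in> \<Omega>"
    obtain x y where xy: "z0 = (x, y)" by fastforce
    obtain d1 where d1: "0 < d1" "\<And>s. \<bar>s - x\<bar> < d1 \<Longrightarrow> (s, y) \<in> \<Omega>"
      using open_segment_x[OF \<Omega>(1) in\<Omega>] unfolding xy by auto
    obtain d2 where d2: "0 < d2" "\<And>s. \<bar>s - y\<bar> < d2 \<Longrightarrow> (x, s) \<in> \<Omega>"
      using open_segment_y[OF \<Omega>(1) in\<Omega>] unfolding xy by auto
    have "dx (dx v) (x, y) + 2 * \<delta> \<le> 0"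
    proof (rule second_derivative_nonpos_at_max[OF d1(1)])
      show "((\<lambda>s. w (s, y)) has_real_derivative dx v (s, y) + 2 * \<delta> * s) (at s)"
        if "\<bar>s - x\<bar> < d1" for s
        unfolding w_def using has_dx[OF diff(1) \<Omega>(1) d1(2)[OF that]]
        by (auto intro!: derivative_eq_intros)
      show "((\<lambda>s. dx v (s, y) + 2 * \<delta> * s) has_real_derivative dx (dx v) (x, y) + 2 * \<delta>) (at x)"
        using has_dx[OF diff(2) \<Omega>(1), of x y] in\<Omega> by (auto simp: xy intro!: derivative_eq_intros)
      show "w (s, y) \<le> w (x, y)" if "\<bar>s - x\<bar> < d1" for s
        using z0(2) d1(2)[OF that] closure_subset xy by blast
    qed
    moreover have "dy (dy v) (x, y) \<le> 0"
    proof (rule second_derivative_nonpos_at_max[OF d2(1)])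
      show "((\<lambda>s. w (x, s)) has_real_derivative dy v (x, s)) (at s)"
        if "\<bar>s - y\<bar> < d2" for s
        unfolding w_def using has_dy[OF diff(1) \<Omega>(1) d2(2)[OF that]]
        by (auto intro!: derivative_eq_intros)
      show "((\<lambda>s. dy v (x, s)) has_real_derivative dy (dy v) (x, y)) (at y)"
        using has_dy[OF diff(3) \<Omega>(1), of x y] in\<Omega> by (simp add: xy)
      show "w (x, s) \<le> w (x, y)" if "\<bar>s - y\<bar> < d2" for s
        using z0(2) d2(2)[OF that] closure_subset xy by blast
    qed
    ultimately show False using lap[OF in\<Omega>] \<delta> xy by simp
  qed
  hence "v z0 \<le> b" using z0(1) \<Omega>(1) by (intro bd) (simp add: frontier_def interior_open)
  have "\<bar>fst z0\<bar> \<le> M" using M(2)[OF z0(1)] norm_fst_le[of "fst z0" "snd z0"] by simp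
  hence "(fst z0)\<^sup>2 \<le> M\<^sup>2" using power_mono[of "\<bar>fst z0\<bar>" M 2] by simp
  hence "\<delta> * (fst z0)\<^sup>2 \<le> \<delta> * M\<^sup>2" using \<delta> by simp
  also have "\<dots> = e" using M(1) by (simp add: \<delta>_def)
  finally have "\<delta> * (fst z0)\<^sup>2 \<le> e" .
  moreover have "v z \<le> w z" using \<delta> by (simp add: w_def)
  moreover have "w z \<le> w z0" using z0(2) z by simp
  ultimately show "v z \<le> b + e" using \<open>v z0 \<le> b\<close> by (simp add: w_def)
qed

lemma dx_cong:
  assumes "open \<Omega>" "z \<in> \<Omega>" "\<And>w. w \<in> \<Omega> \<Longrightarrow> f w = g w"
  shows "dx f z = dx g z"
proof -
  obtain d where "0 < d" "\<And>s. \<bar>s - fst z\<bar> < d \<Longrightarrow> (s, snd z) \<in> \<Omega>"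
    using open_segment_x[OF assms(1,2)] by blast
  hence "\<forall>\<^sub>F s in nhds (fst z). f (s, snd z) = g (s, snd z)"
    using assms(3) by (auto simp: eventually_nhds_metric dist_real_def)
  thus ?thesis unfolding dx_def by (intro deriv_cong_ev) auto
qed

lemma dy_cong:
  assumes "open \<Omega>" "z \<in> \<Omega>" "\<And>w. w \<in> \<Omega> \<Longrightarrow> f w = g w"
  shows "dy f z = dy g z"
proof -
  obtain d where "0 < d" "\<And>s. \<bar>s - snd z\<bar> < d \<Longrightarrow> (fst z, s) \<in> \<Omega>"
    using open_segment_y[OF assms(1,2)] by blast
  hence "\<forall>\<^sub>F s in nhds (snd z). f (fst z, s) = g (fst z, s)"
    using assms(3) by (auto simp: eventually_nhds_metric dist_real_def)
  thus ?thesis unfolding dy_def by (intro deriv_cong_ev) auto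
qed

lemma dx_const [simp]: "dx (\<lambda>w. c) = (\<lambda>w. 0)" and dy_const [simp]: "dy (\<lambda>w. c) = (\<lambda>w. 0)"
  by (simp_all add: fun_eq_iff dx_def dy_def)

lemma dx_cmult:
  assumes "f differentiable_on \<Omega>" "open \<Omega>" "z \<in> \<Omega>"
  shows "dx (\<lambda>w. c * f w) z = c * dx f z"
  using has_dx[OF assms(1,2), of "fst z" "snd z"] assms(3)
  by (auto simp: dx_def[of "\<lambda>w. c * f w"] intro!: DERIV_imp_deriv derivative_eq_intros)

lemma dy_cmult:
  assumes "f differentiable_on \<Omega>" "open \<Omega>" "z \<in> \<Omega>"
  shows "dy (\<lambda>w. c * f w) z = c * dy f z"
  using has_dy[OF assms(1,2), of "fst z" "snd z"] assms(3)
  by (auto simp: dy_def[of "\<lambda>w. c * f w"] intro!: DERIV_imp_deriv derivative_eq_intros)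

lemma differentiable_on_transform:
  "f differentiable_on S \<Longrightarrow> (\<And>w. w \<in> S \<Longrightarrow> f w = g w) \<Longrightarrow> g differentiable_on S"
  unfolding differentiable_on_def by (metis differentiable_transform_within zero_less_one)

text \<open>
  The maximum principle applied to \<open>v\<close> and to \<open>-v\<close>.
\<close>

lemma harmonic_const_boundary:
  fixes v :: "real \<times> real \<Rightarrow> real"
  assumes \<Omega>: "open \<Omega>" "bounded \<Omega>" and cont: "continuous_on (closure \<Omega>) v"
    and diff: "v differentiable_on \<Omega>" "dx v differentiable_on \<Omega>" "dy v differentiable_on \<Omega>"
    and lap: "\<And>z. z \<in> \<Omega> \<Longrightarrow> dx (dx v) z + dy (dy v) z = 0"
    and bd: "\<And>z. z \<in> frontier \<Omega> \<Longrightarrow> v z = b"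
    and z: "z \<in> closure \<Omega>"
  shows "v z = b"
proof (rule antisym)
  show "v z \<le> b"
    by (rule harmonic_le_boundary[OF \<Omega> cont diff lap _ z]) (simp_all add: bd)
  define v' where "v' = (\<lambda>w. - 1 * v w)"
  have x: "dx v' w = - 1 * dx v w" and y: "dy v' w = - 1 * dy v w" if "w \<in> \<Omega>" for w
    using that unfolding v'_def by (rule dx_cmult[OF diff(1) \<Omega>(1)], rule dy_cmult[OF diff(1) \<Omega>(1)])
  have xd: "(\<lambda>w. - 1 * dx v w) differentiable_on \<Omega>" and yd: "(\<lambda>w. - 1 * dy v w) differentiable_on \<Omega>"
    by (intro derivative_intros diff)+
  have "v' z \<le> - b"
  proof (rule harmonic_le_boundary[OF \<Omega> _ _ _ _ _ _ z])
    show "continuous_on (closure \<Omega>) v'" unfolding v'_def by (intro continuous_intros cont)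
    show "v' differentiable_on \<Omega>" unfolding v'_def by (intro derivative_intros diff)
    show "dx v' differentiable_on \<Omega>" "dy v' differentiable_on \<Omega>"
      by (rule differentiable_on_transform[OF xd], simp add: x)
        (rule differentiable_on_transform[OF yd], simp add: y)
    show "dx (dx v') w + dy (dy v') w = 0" if w: "w \<in> \<Omega>" for w
      using lap[OF w] dx_cong[OF \<Omega>(1) w x] dy_cong[OF \<Omega>(1) w y]
        dx_cmult[OF diff(2) \<Omega>(1) w, of "- 1"] dy_cmult[OF diff(3) \<Omega>(1) w, of "- 1"] by simp
  qed (simp_all add: v'_def bd)
  thus "b \<le> v z" by (simp add: v'_def)
qed


section \<open>Leading terms of spatial derivatives\<close>

text \<open>
  A coefficient that is constant in space has zero derivative; hence the coefficientwise derivatives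
  vanish for all sufficiently low orders and do form a Laurent series.
\<close>

lemma nth_Dx:
  assumes \<Omega>: "open \<Omega>" "z \<in> \<Omega>" and const: "\<And>k w. k < N \<Longrightarrow> w \<in> \<Omega> \<Longrightarrow> coef f k w = b k"
  shows "fls_nth (Dx f z) k = dx (coef f k) z"
proof -
  have "dx (coef f k) z = 0" if "k < N" for k
    using dx_cong[OF \<Omega>, of "coef f k" "\<lambda>_. b k"] const[OF that] by simp
  thus ?thesis unfolding Dx_def by (intro nth_Abs_fls_lower_bound) blast
qed

lemma nth_Dy:
  assumes \<Omega>: "open \<Omega>" "z \<in> \<Omega>" and const: "\<And>k w. k < N \<Longrightarrow> w \<in> \<Omega> \<Longrightarrow> coef f k w = b k"
  shows "fls_nth (Dy f z) k = dy (coef f k) z"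
proof -
  have "dy (coef f k) z = 0" if "k < N" for k
    using dy_cong[OF \<Omega>, of "coef f k" "\<lambda>_. b k"] const[OF that] by simp
  thus ?thesis unfolding Dy_def by (intro nth_Abs_fls_lower_bound) blast
qed

lemma leading_Dx:
  assumes \<Omega>: "open \<Omega>" "z \<in> \<Omega>" and const: "\<And>k w. k < m \<Longrightarrow> w \<in> \<Omega> \<Longrightarrow> coef f k w = b k"
  shows "leading (Dx f z) m (dx (coef f m) z)"
proof -
  have "dx (coef f k) z = 0" if "k < m" for k
    using dx_cong[OF \<Omega>, of "coef f k" "\<lambda>_. b k"] const[OF that] by simp
  thus ?thesis using nth_Dx[OF \<Omega> const] by (simp add: leading_def)
qed

lemma leading_Dy:
  assumes \<Omega>: "open \<Omega>" "z \<in> \<Omega>" and const: "\<And>k w. k < m \<Longrightarrow> w \<in> \<Omega> \<Longrightarrow> coef f k w = b k"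
  shows "leading (Dy f z) m (dy (coef f m) z)"
proof -
  have "dy (coef f k) z = 0" if "k < m" for k
    using dy_cong[OF \<Omega>, of "coef f k" "\<lambda>_. b k"] const[OF that] by simp
  thus ?thesis using nth_Dy[OF \<Omega> const] by (simp add: leading_def)
qed


section \<open>The implicit pressure-velocity system\<close>

definition background_pressure :: "real \<Rightarrow> real \<Rightarrow> int \<Rightarrow> real" where
  "background_pressure p0 p1 k = (if k = 0 then p0 else if k = 1 then p1 else 0)"

text \<open>
  The algebraic core shared by both stages.  With \<open>F\<close>, \<open>G\<close>, \<open>B\<close> collecting the explicit terms, velocity and
  pressure of a stage solve
  \<open>u = (F, G) - C \<nabla>p\<close>, \<open>p = B - Q \<nabla> \<cdot> u\<close>, where \<open>C\<close> is of order \<open>\<epsilon>\<^sup>-\<^sup>2\<close>, \<open>Q\<close> is of order one, and both are constant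
  in space.

  Suppose the pressure coefficients below order \<open>m < 2\<close> are already known to be constant.  The
  velocity equation at order \<open>m - 2 < 0\<close> then contains no explicit term and says that \<open>u\<^sub>m\<^sub>-\<^sub>2\<close> is a nonzero
  multiple of \<open>\<nabla>p\<^sub>m\<close>.  The pressure equation at the same order says that \<open>\<nabla> \<cdot> u\<^sub>m\<^sub>-\<^sub>2\<close> vanishes, because \<open>p\<close>
  and \<open>B\<close> have equal coefficients there.  So \<open>p\<^sub>m\<close> is harmonic with constant boundary values, hence
  constant, and \<open>u\<^sub>m\<^sub>-\<^sub>2\<close> is zero.  Starting below the order of all the fields, this reaches
  \<open>m = 1\<close>; after that the velocity has no negative powers, and the pressure equation at orders \<open>0\<close> and
  \<open>1\<close> gives the two divergence constraints.
\<close>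

lemma implicit_pressure_velocity_expansion:
  fixes U V P :: "real \<times> real \<Rightarrow> real fls"
  assumes \<Omega>: "open \<Omega>" "bounded \<Omega>"
    and reg: "regular_field \<Omega> U" "regular_field \<Omega> V" "regular_field \<Omega> P"
    and C: "leading C (- 2) c" "c \<noteq> 0" and Q: "leading Q 0 q" "q \<noteq> 0"
    and U: "\<And>z. z \<in> \<Omega> \<Longrightarrow> U z = F z - C * Dx P z" and F: "\<And>z. z \<in> \<Omega> \<Longrightarrow> leading (F z) 0 (f z)"
    and V: "\<And>z. z \<in> \<Omega> \<Longrightarrow> V z = G z - C * Dy P z" and G: "\<And>z. z \<in> \<Omega> \<Longrightarrow> leading (G z) 0 (g z)"
    and P: "\<And>z. z \<in> \<Omega> \<Longrightarrow> P z = B z - Q * Div U V z"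
    and B: "\<And>z k. z \<in> \<Omega> \<Longrightarrow> k < 2 \<Longrightarrow> fls_nth (B z) k = background_pressure p0 p1 k"
    and bd: "\<And>z k. z \<in> frontier \<Omega> \<Longrightarrow> k < 2 \<Longrightarrow> fls_nth (P z) k = background_pressure p0 p1 k"
  shows "(\<forall>k<2. \<forall>z\<in>closure \<Omega>. coef P k z = background_pressure p0 p1 k) \<and>
         (\<forall>k<0. \<forall>z\<in>closure \<Omega>. coef U k z = 0 \<and> coef V k z = 0) \<and>
         (\<forall>k<2. \<forall>z\<in>\<Omega>. dx (coef U k) z + dy (coef V k) z = 0)"
proof -
  let ?b = "background_pressure p0 p1"
  \<comment> \<open>The velocity lags two orders behind the pressure because \<open>C\<close> is of order \<open>\<epsilon>\<^sup>-\<^sup>2\<close>.\<close>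
  define inv where "inv m \<longleftrightarrow> (\<forall>k<m. \<forall>z\<in>closure \<Omega>. coef P k z = ?b k) \<and>
    (\<forall>k<m - 2. \<forall>z\<in>\<Omega>. coef U k z = 0 \<and> coef V k z = 0)" for m
  obtain NU NV NP where N: "\<forall>k<NU. \<forall>z\<in>closure \<Omega>. coef U k z = 0"
    "\<forall>k<NV. \<forall>z\<in>closure \<Omega>. coef V k z = 0" "\<forall>k<NP. \<forall>z\<in>closure \<Omega>. coef P k z = 0"
    using reg unfolding regular_field_def by blast
  \<comment> \<open>\<open>N \<le> 0\<close>, so that the background pressure vanishes below \<open>N\<close> as well.\<close>
  define N where "N = min (min NU NV) (min NP 0)"
  have Nle: "N \<le> NU" "N \<le> NV" "N \<le> NP" "N \<le> 0" by (simp_all add: N_def)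
  have sub: "\<Omega> \<subseteq> closure \<Omega>" by (rule closure_subset)
  have "inv N" unfolding inv_def using N Nle sub by (auto simp: background_pressure_def)
  have step: "inv (m + 1)" if m: "m < 2" and I: "inv m" for m
  proof -
    let ?U = "coef U (m - 2)" and ?V = "coef V (m - 2)" and ?P = "coef P m"
    have Pc: "coef P k w = ?b k" if "k < m" "w \<in> closure \<Omega>" for k w
      using I that by (auto simp: inv_def)
    have U0: "coef U k w = 0" and V0: "coef V k w = 0" if "k < m - 2" "w \<in> \<Omega>" for k w
      using I that by (auto simp: inv_def)
    have Um: "?U z = - c * dx ?P z" and Vm: "?V z = - c * dy ?P z" if z: "z \<in> \<Omega>" for z
    proof -
      have "leading (Dx P z) m (dx ?P z)" "leading (Dy P z) m (dy ?P z)"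
        using z Pc sub by (auto intro!: leading_Dx[OF \<Omega>(1)] leading_Dy[OF \<Omega>(1)])
      hence "leading (C * Dx P z) (m - 2) (c * dx ?P z)" "leading (C * Dy P z) (m - 2) (c * dy ?P z)"
        using leading_mult[OF C(1)] by fastforce+
      hence "leading (U z) (m - 2) (0 - c * dx ?P z)" "leading (V z) (m - 2) (0 - c * dy ?P z)"
        unfolding U[OF z] V[OF z]
        using m by (intro leading_diff leading_weaken[OF F[OF z]] leading_weaken[OF G[OF z]]; simp)+
      thus "?U z = - c * dx ?P z" "?V z = - c * dy ?P z" by (auto simp: leading_def coef_def)
    qed
    \<comment> \<open>At order \<open>m - 2\<close> the pressure is already known, and it equals the coefficient of \<open>B\<close>.\<close>
    have div0: "dx ?U z + dy ?V z = 0" if z: "z \<in> \<Omega>" for z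
    proof -
      have "leading (Div U V z) (m - 2) (dx ?U z + dy ?V z)"
        unfolding Div_def
        using leading_Dx[OF \<Omega>(1) z, of "m - 2" U "\<lambda>_. 0"] leading_Dy[OF \<Omega>(1) z, of "m - 2" V "\<lambda>_. 0"] U0 V0
        by (auto intro: leading_add)
      from leading_mult[OF Q(1) this]
      have "fls_nth (Q * Div U V z) (m - 2) = q * (dx ?U z + dy ?V z)"
        by (simp add: leading_def)
      moreover have "fls_nth (P z) (m - 2) = ?b (m - 2)"
        using Pc[of "m - 2" z] z sub by (auto simp: coef_def)
      moreover have "fls_nth (B z) (m - 2) = ?b (m - 2)" using B[OF z] m by simp
      ultimately have "q * (dx ?U z + dy ?V z) = 0" using P[OF z] by simp
      thus ?thesis using Q(2) by simp
    qed
    have regm: "?U differentiable_on \<Omega>" "?V differentiable_on \<Omega>" "?P differentiable_on \<Omega>"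
      "continuous_on (closure \<Omega>) ?P" using reg unfolding regular_field_def by blast+
    have dxP: "dx ?P w = - 1 / c * ?U w" and dyP: "dy ?P w = - 1 / c * ?V w" if "w \<in> \<Omega>" for w
      using Um[OF that] Vm[OF that] C(2) by simp_all
    \<comment> \<open>The gradient of \<open>p\<^sub>m\<close> is a multiple of the velocity coefficient, and hence differentiable.\<close>
    have P_const: "?P z = ?b m" if "z \<in> closure \<Omega>" for z
    proof (rule harmonic_const_boundary[OF \<Omega> regm(4,3) _ _ _ _ that])
      have Ud: "(\<lambda>w. - 1 / c * ?U w) differentiable_on \<Omega>" and Vd: "(\<lambda>w. - 1 / c * ?V w) differentiable_on \<Omega>"
        by (intro derivative_intros regm)+
      show "dx ?P differentiable_on \<Omega>" using Ud by (rule differentiable_on_transform) (simp add: dxP)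
      show "dy ?P differentiable_on \<Omega>" using Vd by (rule differentiable_on_transform) (simp add: dyP)
      show "dx (dx ?P) w + dy (dy ?P) w = 0" if w: "w \<in> \<Omega>" for w
      proof -
        have "dx (dx ?P) w = - 1 / c * dx ?U w" "dy (dy ?P) w = - 1 / c * dy ?V w"
          using dx_cong[OF \<Omega>(1) w dxP] dy_cong[OF \<Omega>(1) w dyP]
            dx_cmult[OF regm(1) \<Omega>(1) w, of "- 1 / c"] dy_cmult[OF regm(2) \<Omega>(1) w, of "- 1 / c"]
          by (simp_all only:)
        hence "dx (dx ?P) w + dy (dy ?P) w = - 1 / c * (dx ?U w + dy ?V w)"
          by (simp only: distrib_left)
        thus ?thesis using div0[OF w] by simp
      qed
      show "?P w = ?b m" if "w \<in> frontier \<Omega>" for w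
        using bd[OF that m] by (simp add: coef_def)
    qed
    have UV0: "?U z = 0 \<and> ?V z = 0" if z: "z \<in> \<Omega>" for z
      using Um[OF z] Vm[OF z] dx_cong[OF \<Omega>(1) z, of ?P "\<lambda>_. ?b m"] dy_cong[OF \<Omega>(1) z, of ?P "\<lambda>_. ?b m"]
        P_const sub by auto
    show "inv (m + 1)" unfolding inv_def
    proof (intro conjI allI impI ballI)
      show "coef P k z = ?b k" if "k < m + 1" "z \<in> closure \<Omega>" for k z
        using that Pc P_const by (cases "k = m") auto
      show "coef U k z = 0" "coef V k z = 0" if "k < m + 1 - 2" "z \<in> \<Omega>" for k z
        using that U0 V0 UV0 by (cases "k = m - 2"; auto)+
    qed
  qed
  have "m \<le> 2 \<longrightarrow> inv m" if "N \<le> m" for m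
    using that by (induction m rule: int_ge_induct) (use \<open>inv N\<close> step in auto)
  hence "inv 2" using Nle by auto
  hence Pc: "coef P k z = ?b k" if "k < 2" "z \<in> closure \<Omega>" for k z
    using that by (auto simp: inv_def)
  have UV0: "coef U k z = 0 \<and> coef V k z = 0" if "k < 0" "z \<in> \<Omega>" for k z
    using \<open>inv 2\<close> that by (auto simp: inv_def)
  have UV0c: "coef U k z = 0 \<and> coef V k z = 0" if "k < 0" "z \<in> closure \<Omega>" for k z
  proof -
    have "continuous_on (closure \<Omega>) (coef U k)" "continuous_on (closure \<Omega>) (coef V k)"
      using reg unfolding regular_field_def by blast+
    thus ?thesis using UV0 that by (auto intro: continuous_constant_on_closure)
  qed
  have nthD: "fls_nth (Div U V z) k = dx (coef U k) z + dy (coef V k) z" if z: "z \<in> \<Omega>" for z k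
    using nth_Dx[OF \<Omega>(1) z, of 0 U "\<lambda>_. 0"] nth_Dy[OF \<Omega>(1) z, of 0 V "\<lambda>_. 0"] UV0
    by (simp add: Div_def)
  \<comment> \<open>The pressure equation determines the first possibly nonzero coefficient of the divergence,
    so orders \<open>0\<close> and \<open>1\<close> are treated one after the other.\<close>
  have divk: "fls_nth (Div U V z) k = 0" if z: "z \<in> \<Omega>" and k: "k < 2" and lo: "\<forall>j<k. fls_nth (Div U V z) j = 0" for z k
  proof -
    have "leading (Div U V z) k (fls_nth (Div U V z) k)" using lo by (simp add: leading_def)
    from leading_mult[OF Q(1) this]
    have "fls_nth (Q * Div U V z) k = q * fls_nth (Div U V z) k" by (simp add: leading_def)
    moreover have "fls_nth (P z) k = ?b k" using Pc[OF k, of z] z sub by (auto simp: coef_def)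
    ultimately have "q * fls_nth (Div U V z) k = 0" using P[OF z] B[OF z k] by simp
    thus ?thesis using Q(2) by simp
  qed
  have div_neg: "fls_nth (Div U V z) k = 0" if z: "z \<in> \<Omega>" and k: "k < 0" for z k
    using leading_Dx[OF \<Omega>(1) z, of 0 U "\<lambda>_. 0"] leading_Dy[OF \<Omega>(1) z, of 0 V "\<lambda>_. 0"] UV0 k
    by (simp add: Div_def leading_def)
  have div_0: "fls_nth (Div U V z) 0 = 0" if z: "z \<in> \<Omega>" for z
    using divk[OF z] div_neg[OF z] by simp
  have div_1: "fls_nth (Div U V z) 1 = 0" if z: "z \<in> \<Omega>" for z
  proof (rule divk[OF z])
    show "\<forall>j<1. fls_nth (Div U V z) j = 0"
      using div_neg[OF z] div_0[OF z] by (metis linorder_neqE_linordered_idom zle_add1_eq_le not_less add_0)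
  qed simp
  have "fls_nth (Div U V z) k = 0" if z: "z \<in> \<Omega>" and k: "k < 2" for z k
  proof -
    from k consider "k < 0" | "k = 0" | "k = 1" by linarith
    thus ?thesis using div_neg[OF z] div_0[OF z] div_1[OF z] by cases auto
  qed
  thus ?thesis using Pc UV0c nthD by auto
qed


section \<open>Consistency of the limit increments\<close>

lemma tendsto_shift_at_right: "((\<lambda>h. t + h) \<longlongrightarrow> t) (at_right (0::real))"
  using tendsto_add[OF tendsto_const[of t] tendsto_ident_at[of 0 "{0<..}"]] by simp

lemma eventually_shift_at_right:
  "open T \<Longrightarrow> t \<in> T \<Longrightarrow> \<forall>\<^sub>F h in at_right (0::real). t + h \<in> T"
  by (rule topological_tendstoD[OF tendsto_shift_at_right])

lemma tendsto_time_slice: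
  assumes cont: "continuous_on ({a<..<b} \<times> S) (\<lambda>(t, z). f t z)"
    and t: "t \<in> {a<..<b}" and z: "z \<in> S"
  shows "((\<lambda>h. f (t + h) z) \<longlongrightarrow> f t z) (at_right (0::real))"
proof -
  have "continuous_on {a<..<b} (\<lambda>s. case (s, z) of (t, z) \<Rightarrow> f t z)"
    by (rule continuous_on_compose2[OF cont]) (auto intro!: continuous_intros simp: z)
  hence "isCont (\<lambda>s. f s z) t" using t by (simp add: continuous_on_eq_continuous_at)
  thus ?thesis using tendsto_shift_at_right by (rule isCont_tendsto_compose)
qed

text \<open>
  The increments contain the density maximum over the domain, which depends on time through all
  points at once; compactness of the closed domain makes the density continuous in time uniformly in
  space.
\<close>

lemma tendsto_max_density:
  fixes y :: "real \<Rightarrow> real flow"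
  assumes cont: "continuous_on ({a<..<b} \<times> closure \<Omega>) (\<lambda>(t, z). rho (y t) z)"
    and t: "t \<in> {a<..<b}" and bnd: "bounded \<Omega>" and ne: "\<Omega> \<noteq> {}"
  shows "((\<lambda>h. max_density \<Omega> (y (t + h))) \<longlongrightarrow> max_density \<Omega> (y t)) (at_right 0)"
proof (rule tendstoI)
  fix e :: real assume "0 < e"
  have cpt: "compact (closure \<Omega>)" using bnd by (simp add: compact_closure)
  have bdd: "bdd_above (rho (y s) ` closure \<Omega>)" if "s \<in> {a<..<b}" for s
  proof -
    have "continuous_on (closure \<Omega>) (\<lambda>z. case (s, z) of (t, z) \<Rightarrow> rho (y t) z)"
      by (rule continuous_on_compose2[OF cont]) (use that in \<open>auto intro!: continuous_intros\<close>)
    thus ?thesis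
      using cpt by (auto intro!: bounded_imp_bdd_above compact_imp_bounded compact_continuous_image)
  qed
  have le: "max_density \<Omega> (y s) \<le> max_density \<Omega> (y s') + d"
    if "s' \<in> {a<..<b}" "\<And>z. z \<in> closure \<Omega> \<Longrightarrow> rho (y s) z \<le> rho (y s') z + d" for s s' d
    unfolding max_density_def
  proof (rule cSUP_least)
    show "closure \<Omega> \<noteq> {}" using ne by simp
    fix z assume z: "z \<in> closure \<Omega>"
    have "rho (y s') z \<le> (SUP z\<in>closure \<Omega>. rho (y s') z)"
      using z bdd[OF that(1)] by (rule cSUP_upper)
    with that(2)[OF z] show "rho (y s) z \<le> (SUP z\<in>closure \<Omega>. rho (y s') z) + d" by simp
  qed
  obtain T where T: "t \<in> T" "open T"
    and T_close: "\<forall>s\<in>T \<inter> {a<..<b}. \<forall>z\<in>closure \<Omega>.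
      dist (case (s, z) of (t, z) \<Rightarrow> rho (y t) z) (case (t, z) of (t, z) \<Rightarrow> rho (y t) z) \<le> e / 2"
    by (rule continuous_on_prod_compactE[OF cont cpt t half_gt_zero[OF \<open>0 < e\<close>]])
  have "\<forall>\<^sub>F h in at_right 0. t + h \<in> T \<inter> {a<..<b}"
    using T t by (intro eventually_shift_at_right) auto
  thus "\<forall>\<^sub>F h in at_right 0. dist (max_density \<Omega> (y (t + h))) (max_density \<Omega> (y t)) < e"
  proof eventually_elim
    case (elim h)
    have close: "rho (y (t + h)) z \<le> rho (y t) z + e / 2" "rho (y t) z \<le> rho (y (t + h)) z + e / 2"
      if "z \<in> closure \<Omega>" for z
      using T_close[rule_format, OF elim that] unfolding dist_real_def prod.case by linarith+
    have "max_density \<Omega> (y (t + h)) \<le> max_density \<Omega> (y t) + e / 2"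
      by (rule le[OF t close(1)])
    moreover have "max_density \<Omega> (y t) \<le> max_density \<Omega> (y (t + h)) + e / 2"
      using elim by (intro le close(2)) (rule IntD2)
    ultimately show ?case using \<open>0 < e\<close> unfolding dist_real_def by linarith
  qed
qed

lemma max_density_pos:
  assumes "continuous_on (closure \<Omega>) (rho y)" "bounded \<Omega>" "\<Omega> \<noteq> {}"
    and pos: "\<And>z. z \<in> closure \<Omega> \<Longrightarrow> 0 < rho y z"
  shows "0 < max_density \<Omega> y"
proof -
  obtain z where z: "z \<in> closure \<Omega>" using assms(3) closure_subset by blast
  have "compact (rho y ` closure \<Omega>)"
    using assms by (intro compact_continuous_image) (auto simp: compact_closure)
  hence "bdd_above (rho y ` closure \<Omega>)" by (simp add: bounded_imp_bdd_above compact_imp_bounded)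
  hence "rho y z \<le> max_density \<Omega> y" unfolding max_density_def using z by (rule cSUP_upper[rotated])
  with pos[OF z] show ?thesis by simp
qed

lemma mass_flux_div_expand:
  assumes "rho y differentiable_on \<Omega>" "velx y differentiable_on \<Omega>" "vely y differentiable_on \<Omega>"
    and "open \<Omega>" "z \<in> \<Omega>"
  shows "mass_flux_div y z =
    dx (rho y) z * velx y z + rho y z * dx (velx y) z + (dy (rho y) z * vely y z + rho y z * dy (vely y) z)"
proof -
  obtain s t where z: "z = (s, t)" by fastforce
  have "dx (\<lambda>z. rho y z * velx y z) z = dx (rho y) z * velx y z + rho y z * dx (velx y) z"
    unfolding dx_def[of "\<lambda>z. rho y z * velx y z"]
    using has_dx[OF assms(1,4), of s t] has_dx[OF assms(2,4), of s t] assms(5)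
    by (intro DERIV_imp_deriv) (auto simp: z mult.commute intro!: derivative_eq_intros)
  moreover have "dy (\<lambda>z. rho y z * vely y z) z = dy (rho y) z * vely y z + rho y z * dy (vely y) z"
    unfolding dy_def[of "\<lambda>z. rho y z * vely y z"]
    using has_dy[OF assms(1,4), of s t] has_dy[OF assms(3,4), of s t] assms(5)
    by (intro DERIV_imp_deriv) (auto simp: z mult.commute intro!: derivative_eq_intros)
  ultimately show ?thesis by (simp add: mass_flux_div_def)
qed

lemma forward_difference_quotient:
  assumes "((f :: real \<Rightarrow> real) has_real_derivative D) (at t)"
  shows "((\<lambda>h. (f (t + h) - f t) /\<^sub>R h) \<longlongrightarrow> D) (at_right 0)"
proof -
  have "((\<lambda>h. (f (t + h) - f t) / h) \<longlongrightarrow> D) (at_right 0)"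
    using assms by (simp add: DERIV_def filterlim_at_split)
  thus ?thesis by (simp only: real_scaleR_def divide_inverse_commute)
qed

text \<open>
  The scheme splits the factor \<open>1/\<rho>\<close> of the pressure gradient into \<open>(r - \<rho>)/(\<rho> r)\<close>, treated explicitly, and \<open>1/r\<close>,
  treated implicitly, where \<open>r\<close> is the density maximum.  All fields depend continuously on time,
  so as the step tends to zero the parts recombine, in the second stage after averaging, and both
  increments tend to the right-hand side of the limit equations.
\<close>

lemma limit_increments_consistent:
  assumes \<Omega>: "open \<Omega>" "bounded \<Omega>" "\<Omega> \<noteq> {}"
  shows "consistent_increments \<Omega> (limit_increment1 \<Omega>) (limit_increment2 \<Omega>)"
  unfolding consistent_increments_def
proof (intro allI impI ballI conjI)
  fix a b y t z
  assume sol: "limit_solution \<Omega> a b y" and t: "t \<in> {a<..<b}" and z: "z \<in> \<Omega>"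
  have zc: "z \<in> closure \<Omega>" using z closure_subset by blast
  let ?W = "{\<lambda>t. rho (y t), \<lambda>t. velx (y t), \<lambda>t. vely (y t), \<lambda>t. prs (y t)}"
  have sol_W: "continuous_on ({a<..<b} \<times> closure \<Omega>) (\<lambda>(t, z). w t z) \<and>
      (\<forall>t\<in>{a<..<b}. w t differentiable_on \<Omega>) \<and>
      continuous_on ({a<..<b} \<times> \<Omega>) (\<lambda>(t, z). dx (w t) z) \<and>
      continuous_on ({a<..<b} \<times> \<Omega>) (\<lambda>(t, z). dy (w t) z)" if "w \<in> ?W" for w
    using sol[unfolded limit_solution_def, THEN conjunct1] that by (rule bspec)
  have W: "continuous_on ({a<..<b} \<times> closure \<Omega>) (\<lambda>(t, z). w t z)"
    "\<And>t. t \<in> {a<..<b} \<Longrightarrow> w t differentiable_on \<Omega>"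
    "((\<lambda>h. w (t + h) z) \<longlongrightarrow> w t z) (at_right 0)"
    "((\<lambda>h. dx (w (t + h)) z) \<longlongrightarrow> dx (w t) z) (at_right 0)"
    "((\<lambda>h. dy (w (t + h)) z) \<longlongrightarrow> dy (w t) z) (at_right 0)" if w: "w \<in> ?W" for w
  proof -
    note w4 = sol_W[OF w]
    note w_cont = w4[THEN conjunct1] and w_diff = w4[THEN conjunct2, THEN conjunct1]
      and w_dx = w4[THEN conjunct2, THEN conjunct2, THEN conjunct1]
      and w_dy = w4[THEN conjunct2, THEN conjunct2, THEN conjunct2]
    show "continuous_on ({a<..<b} \<times> closure \<Omega>) (\<lambda>(t, z). w t z)" by (rule w_cont)
    show "w t differentiable_on \<Omega>" if "t \<in> {a<..<b}" for t using w_diff that by (rule bspec)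
    show "((\<lambda>h. w (t + h) z) \<longlongrightarrow> w t z) (at_right 0)" by (rule tendsto_time_slice[OF w_cont t zc])
    show "((\<lambda>h. dx (w (t + h)) z) \<longlongrightarrow> dx (w t) z) (at_right 0)" by (rule tendsto_time_slice[OF w_dx t z])
    show "((\<lambda>h. dy (w (t + h)) z) \<longlongrightarrow> dy (w t) z) (at_right 0)" by (rule tendsto_time_slice[OF w_dy t z])
  qed
  note lim_rho = W[of "\<lambda>t. rho (y t)", simplified]
  note lim_velx = W[of "\<lambda>t. velx (y t)", simplified]
  note lim_vely = W[of "\<lambda>t. vely (y t)", simplified]
  note lim_prs = W[of "\<lambda>t. prs (y t)", simplified]
  have pos: "\<And>z. z \<in> closure \<Omega> \<Longrightarrow> 0 < rho (y t) z" and
    ode: "((\<lambda>s. rho (y s) z) has_real_derivative - mass_flux_div (y t) z) (at t)"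
      "((\<lambda>s. velx (y s) z) has_real_derivative
           - adv (y t) (velx (y t)) z - 1 / rho (y t) z * dx (prs (y t)) z) (at t)"
      "((\<lambda>s. vely (y s) z) has_real_derivative
           - adv (y t) (vely (y t)) z - 1 / rho (y t) z * dy (prs (y t)) z) (at t)"
    using sol t z by (auto simp: limit_solution_def)
  have rho_pos: "0 < rho (y t) z" using pos zc by blast
  define r where "r = max_density \<Omega> (y t)"
  have "continuous_on (closure \<Omega>) (\<lambda>z. case (t, z) of (t, z) \<Rightarrow> rho (y t) z)"
    by (rule continuous_on_compose2[OF lim_rho(1)]) (use t in \<open>auto intro!: continuous_intros\<close>)
  hence r_pos: "0 < r" unfolding r_def using \<Omega> pos by (intro max_density_pos) auto
  have lim_r: "((\<lambda>h. max_density \<Omega> (y (t + h))) \<longlongrightarrow> r) (at_right 0)"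
    unfolding r_def by (rule tendsto_max_density[OF lim_rho(1) t \<Omega>(2,3)])
  have lim_adv: "((\<lambda>h. adv (y (t + h)) (velx (y (t + h))) z) \<longlongrightarrow> adv (y t) (velx (y t)) z) (at_right 0)"
    "((\<lambda>h. adv (y (t + h)) (vely (y (t + h))) z) \<longlongrightarrow> adv (y t) (vely (y t)) z) (at_right 0)"
    unfolding adv_def by (intro tendsto_intros lim_velx(3-) lim_vely(3-))+
  have lim_mass: "((\<lambda>h. mass_flux_div (y (t + h)) z) \<longlongrightarrow> mass_flux_div (y t) z) (at_right 0)"
  proof -
    have "\<forall>\<^sub>F h in at_right 0. t + h \<in> {a<..<b}"
      using t by (intro eventually_shift_at_right) auto
    hence ev: "\<forall>\<^sub>F h in at_right 0. mass_flux_div (y (t + h)) z =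
        dx (rho (y (t + h))) z * velx (y (t + h)) z + rho (y (t + h)) z * dx (velx (y (t + h))) z +
        (dy (rho (y (t + h))) z * vely (y (t + h)) z + rho (y (t + h)) z * dy (vely (y (t + h))) z)"
    proof eventually_elim
      case (elim h)
      show ?case by (rule mass_flux_div_expand[OF lim_rho(2) lim_velx(2) lim_vely(2) \<Omega>(1) z]) (use elim in simp)+
    qed
    have "mass_flux_div (y t) z =
        dx (rho (y t)) z * velx (y t) z + rho (y t) z * dx (velx (y t)) z +
        (dy (rho (y t)) z * vely (y t) z + rho (y t) z * dy (vely (y t)) z)"
      by (rule mass_flux_div_expand[OF lim_rho(2) lim_velx(2) lim_vely(2) \<Omega>(1) z]) (use t in simp)+
    thus ?thesis unfolding tendsto_cong[OF ev]
      by (simp only:) (intro tendsto_intros lim_rho(3-) lim_velx(3-) lim_vely(3-))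
  qed
  define D where "D = (- mass_flux_div (y t) z,
     - adv (y t) (velx (y t)) z - 1 / rho (y t) z * dx (prs (y t)) z,
     - adv (y t) (vely (y t)) z - 1 / rho (y t) z * dy (prs (y t)) z)"
  have diff: "((\<lambda>h. (evolved (y (t + h)) z - evolved (y t) z) /\<^sub>R h) \<longlongrightarrow> D) (at_right 0)"
    unfolding evolved_def D_def minus_prod_def scaleR_prod_def fst_conv snd_conv
    by (intro tendsto_Pair forward_difference_quotient ode)
  have split_pressure: "(r - rho (y t) z) / (rho (y t) z * r) * g + 1 / r * g = 1 / rho (y t) z * g" for g
    using rho_pos r_pos by (simp add: field_simps)
  have "((\<lambda>h. limit_increment1 \<Omega> (y t) (y (t + h)) z) \<longlongrightarrow> limit_increment1 \<Omega> (y t) (y t) z) (at_right 0)"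
    unfolding limit_increment1_def Let_def
    by (intro tendsto_Pair tendsto_intros lim_prs(3-))
  moreover have "limit_increment1 \<Omega> (y t) (y t) z = D"
    unfolding limit_increment1_def Let_def D_def r_def[symmetric]
    using split_pressure[of "dx (prs (y t)) z"] split_pressure[of "dy (prs (y t)) z"] by simp
  ultimately have inc1: "((\<lambda>h. limit_increment1 \<Omega> (y t) (y (t + h)) z) \<longlongrightarrow> D) (at_right 0)" by simp
  have average: "- (A + A + X + X) / 2 - (G - G) / 2 - Y = - A - Z" if "X + Y = Z" for A X Y Z G :: real
    using that by auto
  have "((\<lambda>h. limit_increment2 \<Omega> (y t) (y (t + h)) (y (t + h)) z)
      \<longlongrightarrow> limit_increment2 \<Omega> (y t) (y t) (y t) z) (at_right 0)"
    unfolding limit_increment2_def Let_def r_def[symmetric]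
    by (intro tendsto_Pair tendsto_intros lim_prs(3-) lim_rho(3-) lim_mass lim_adv lim_r)
       (use rho_pos r_pos in auto)
  moreover have "limit_increment2 \<Omega> (y t) (y t) (y t) z = D"
    unfolding limit_increment2_def Let_def D_def r_def[symmetric] prod.inject
    by (intro conjI average split_pressure) simp
  ultimately have inc2: "((\<lambda>h. limit_increment2 \<Omega> (y t) (y (t + h)) (y (t + h)) z) \<longlongrightarrow> D) (at_right 0)"
    by simp
  show "((\<lambda>h. (evolved (y (t + h)) z - evolved (y t) z) /\<^sub>R h
              - limit_increment1 \<Omega> (y t) (y (t + h)) z) \<longlongrightarrow> 0) (at_right 0)"
    using tendsto_diff[OF diff inc1] by simp
  show "((\<lambda>h. (evolved (y (t + h)) z - evolved (y t) z) /\<^sub>R h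
              - limit_increment2 \<Omega> (y t) (y (t + h)) (y (t + h)) z) \<longlongrightarrow> 0) (at_right 0)"
    using tendsto_diff[OF diff inc2] by simp
qed


section \<open>The terms of the scheme for well-prepared states\<close>

text \<open>
  The squared sound speed of the splitting is of order one, although it carries the factor \<open>\<epsilon>\<^sup>-\<^sup>2\<close>:
  pressures at two points differ only from order two on.
\<close>

lemma leading_cfl_term:
  assumes "leading \<rho> 0 a" "leading R 0 r" "leading (P - Q) 2 g" "a \<noteq> 0" "r \<noteq> 0"
  shows "leading (1 / eps\<^sup>2 * (fls_const \<gamma> * ((R - \<rho>) * (P - Q) / (\<rho> * R)))) 0
    (\<gamma> * ((r - a) * g / (a * r)))"
proof -
  have "leading (1 / eps\<^sup>2) (0 - 2) (1 / 1 :: real)"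
    by (intro leading_divide leading_eps_squared) (simp_all add: leading_def)
  moreover have "leading (fls_const \<gamma> * ((R - \<rho>) * (P - Q) / (\<rho> * R))) (0 + (0 + 2 - (0 + 0)))
    (\<gamma> * ((r - a) * g / (a * r)))"
    using assms by (intro leading_mult leading_divide leading_diff leading_const) auto
  ultimately show ?thesis using leading_mult by fastforce
qed

text \<open>
  The stiff explicit term is harmless since the pressure gradient is of order two.
\<close>

lemma leading_explicit_pressure:
  assumes "leading \<rho> 0 a" "leading R 0 r" "leading G 2 g" "a \<noteq> 0" "r \<noteq> 0"
  shows "leading ((R - \<rho>) / (eps\<^sup>2 * \<rho> * R) * G) 0 ((r - a) / (a * r) * g)"
proof -
  have "leading ((R - \<rho>) / (eps\<^sup>2 * \<rho> * R) * G) (0 - (2 + 0 + 0) + 2) ((r - a) / (1 * a * r) * g)"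
    using assms by (intro leading_mult leading_divide leading_diff leading_eps_squared) auto
  thus ?thesis by simp
qed

lemma well_prepared_leading:
  assumes wp: "well_prepared \<Omega> p0 p1 S" and z: "z \<in> closure \<Omega>"
  shows "leading (rho S z) 0 (rho (limit_state S) z)"
    "leading (velx S z) 0 (velx (limit_state S) z)"
    "leading (vely S z) 0 (vely (limit_state S) z)"
    "leading (prs S z) 0 p0"
    "k < 2 \<Longrightarrow> fls_nth (prs S z) k = background_pressure p0 p1 k"
proof -
  have "coef (rho S) k z = 0 \<and> coef (velx S) k z = 0 \<and> coef (vely S) k z = 0 \<and> coef (prs S) k z = 0"
    if "k < 0" for k using wp z that unfolding well_prepared_def by blast
  moreover have "coef (prs S) 0 z = p0" "coef (prs S) 1 z = p1"
    using wp z unfolding well_prepared_def by blast+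
  moreover have "k < 0 \<or> k = 0 \<or> k = 1" if "k < 2" using that by linarith
  ultimately show "leading (rho S z) 0 (rho (limit_state S) z)"
    "leading (velx S z) 0 (velx (limit_state S) z)"
    "leading (vely S z) 0 (vely (limit_state S) z)"
    "leading (prs S z) 0 p0"
    "k < 2 \<Longrightarrow> fls_nth (prs S z) k = background_pressure p0 p1 k"
    by (auto simp: leading_def coef_def limit_state_def background_pressure_def)
qed

text \<open>
  The terms of the scheme for a well-prepared state, with the operators of the limit equations as leading
  coefficients: products have the products of the coefficients as leading terms, the constant
  pressures of order \<open>0\<close> and \<open>1\<close> drop out under differentiation, and the divergence of the velocity starts
  at order two by the two constraints.
\<close>

lemma well_prepared_leading_derivatives:
  assumes \<Omega>: "open \<Omega>" and wp: "well_prepared \<Omega> p0 p1 S" and z: "z \<in> \<Omega>"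
  shows "leading (Mass_flux_div S z) 0 (mass_flux_div (limit_state S) z)"
    "leading (Adv S (velx S) z) 0 (adv (limit_state S) (velx (limit_state S)) z)"
    "leading (Adv S (vely S) z) 0 (adv (limit_state S) (vely (limit_state S)) z)"
    "leading (Dx (prs S) z) 2 (dx (prs (limit_state S)) z)"
    "leading (Dy (prs S) z) 2 (dy (prs (limit_state S)) z)"
    "leading (Adv S (prs S) z) 2 (adv (limit_state S) (prs (limit_state S)) z)"
    "leading (DivU S z) 2 (fls_nth (DivU S z) 2)"
proof -
  let ?y = "limit_state S"
  note at = well_prepared_leading[OF wp]
  have sub: "w \<in> closure \<Omega>" if "w \<in> \<Omega>" for w using that closure_subset by blast
  have coef0: "coef (rho S) 0 = rho ?y" "coef (velx S) 0 = velx ?y" "coef (vely S) 0 = vely ?y"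
    "coef (prs S) 2 = prs ?y" by (simp_all add: limit_state_def)
  have neg: "coef (velx S) k w = 0" "coef (vely S) k w = 0" if "k < 0" "w \<in> \<Omega>" for k w
    using leading_nth_below[OF at(2)[OF sub[OF that(2)]] that(1)]
      leading_nth_below[OF at(3)[OF sub[OF that(2)]] that(1)] by (simp_all add: coef_def)
  have flux: "leading (rho S w * velx S w) 0 (rho ?y w * velx ?y w)"
    "leading (rho S w * vely S w) 0 (rho ?y w * vely ?y w)" if "w \<in> \<Omega>" for w
    using leading_mult[OF at(1) at(2)] leading_mult[OF at(1) at(3)] sub[OF that] by fastforce+
  have "leading (Dx (\<lambda>z. rho S z * velx S z) z) 0 (dx (coef (\<lambda>z. rho S z * velx S z) 0) z)"
    using flux by (intro leading_Dx[OF \<Omega> z, where b = "\<lambda>_. 0"]) (auto simp: coef_def leading_def)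
  moreover have "dx (coef (\<lambda>z. rho S z * velx S z) 0) z = dx (\<lambda>z. rho ?y z * velx ?y z) z"
    using flux by (intro dx_cong[OF \<Omega> z]) (auto simp: coef_def leading_def)
  moreover have "leading (Dy (\<lambda>z. rho S z * vely S z) z) 0 (dy (coef (\<lambda>z. rho S z * vely S z) 0) z)"
    using flux by (intro leading_Dy[OF \<Omega> z, where b = "\<lambda>_. 0"]) (auto simp: coef_def leading_def)
  moreover have "dy (coef (\<lambda>z. rho S z * vely S z) 0) z = dy (\<lambda>z. rho ?y z * vely ?y z) z"
    using flux by (intro dy_cong[OF \<Omega> z]) (auto simp: coef_def leading_def)
  ultimately show "leading (Mass_flux_div S z) 0 (mass_flux_div ?y z)"
    unfolding Mass_flux_div_def Div_def mass_flux_div_def by (auto intro: leading_add)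
  have D: "leading (Dx (velx S) z) 0 (dx (velx ?y) z)" "leading (Dy (velx S) z) 0 (dy (velx ?y) z)"
    "leading (Dx (vely S) z) 0 (dx (vely ?y) z)" "leading (Dy (vely S) z) 0 (dy (vely ?y) z)"
    unfolding coef0[symmetric] using neg
    by (auto intro!: leading_Dx[OF \<Omega> z, where b = "\<lambda>_. 0"] leading_Dy[OF \<Omega> z, where b = "\<lambda>_. 0"])
  show Dp: "leading (Dx (prs S) z) 2 (dx (prs ?y) z)" "leading (Dy (prs S) z) 2 (dy (prs ?y) z)"
    unfolding coef0[symmetric] using at(5) sub
    by (auto intro!: leading_Dx[OF \<Omega> z, where b = "background_pressure p0 p1"]
        leading_Dy[OF \<Omega> z, where b = "background_pressure p0 p1"] simp: coef_def)
  note u = at(2,3)[OF sub[OF z]]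
  have "leading (Adv S (velx S) z) (0 + 0) (adv ?y (velx ?y) z)"
    "leading (Adv S (vely S) z) (0 + 0) (adv ?y (vely ?y) z)"
    "leading (Adv S (prs S) z) (0 + 2) (adv ?y (prs ?y) z)"
    unfolding Adv_def adv_def by (intro leading_add leading_mult u D Dp)+
  thus "leading (Adv S (velx S) z) 0 (adv ?y (velx ?y) z)"
    "leading (Adv S (vely S) z) 0 (adv ?y (vely ?y) z)"
    "leading (Adv S (prs S) z) 2 (adv ?y (prs ?y) z)" by simp_all
  have nth: "fls_nth (DivU S z) k = dx (coef (velx S) k) z + dy (coef (vely S) k) z" for k
    unfolding DivU_def Div_def
    using nth_Dx[OF \<Omega> z, of 0 "velx S" "\<lambda>_. 0"] nth_Dy[OF \<Omega> z, of 0 "vely S" "\<lambda>_. 0"] neg by simp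
  have "fls_nth (DivU S z) k = 0" if "k < 2" for k
  proof -
    have "leading (DivU S z) 0 (dx (velx ?y) z + dy (vely ?y) z)"
      unfolding DivU_def Div_def by (intro leading_add D)
    hence "fls_nth (DivU S z) k = 0" if "k < 0" using that by (simp add: leading_def)
    moreover have "fls_nth (DivU S z) 0 = 0" "fls_nth (DivU S z) 1 = 0"
      using wp z unfolding nth well_prepared_def by blast+
    moreover have "k < 0 \<or> k = 0 \<or> k = 1" using \<open>k < 2\<close> by linarith
    ultimately show ?thesis by auto
  qed
  thus "leading (DivU S z) 2 (fls_nth (DivU S z) 2)" by (simp add: leading_def)
qed

text \<open>
  In the order of the Laurent field a point of maximal density also maximizes the leading coefficient, so the
  limit of the maximum is the maximum of the limit density.
\<close>

lemma max_density_leading: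
  assumes wp: "well_prepared \<Omega> p0 p1 S" and pos: "positive_density \<Omega> S"
    and max: "is_max_on (closure \<Omega>) (rho S) R"
  shows "leading R 0 (max_density \<Omega> (limit_state S))" "0 < max_density \<Omega> (limit_state S)"
proof -
  let ?y = "limit_state S"
  obtain z0 where z0: "z0 \<in> closure \<Omega>" "R = rho S z0" and le: "\<And>z. z \<in> closure \<Omega> \<Longrightarrow> rho S z \<le> R"
    using max unfolding is_max_on_def by blast
  have "rho ?y z \<le> rho ?y z0" if "z \<in> closure \<Omega>" for z
    using le[OF that] well_prepared_leading(1)[OF wp that] well_prepared_leading(1)[OF wp z0(1)]
    unfolding z0(2) by (rule leading_coefficient_mono)
  hence "max_density \<Omega> ?y = rho ?y z0"
    unfolding max_density_def using z0(1) by (intro cSup_eq_maximum) auto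
  thus "leading R 0 (max_density \<Omega> ?y)" "0 < max_density \<Omega> ?y"
    using well_prepared_leading(1)[OF wp z0(1)] pos z0
    by (simp_all add: positive_density_def limit_state_def)
qed

text \<open>
  A minimum is the pressure at some point, and all points share the pressure coefficients of order
  \<open>0\<close> and \<open>1\<close>.
\<close>

lemma min_pressure_leading:
  assumes wp: "well_prepared \<Omega> p0 p1 S" and min: "is_min_on (closure \<Omega>) (prs S) Q"
  shows "leading Q 0 p0" "z \<in> closure \<Omega> \<Longrightarrow> leading (prs S z - Q) 2 (fls_nth (prs S z - Q) 2)"
proof -
  obtain z0 where z0: "z0 \<in> closure \<Omega>" "Q = prs S z0"
    using min unfolding is_min_on_def by blast
  show "leading Q 0 p0" using well_prepared_leading(4)[OF wp z0(1)] z0(2) by simp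
  show "leading (prs S z - Q) 2 (fls_nth (prs S z - Q) 2)" if z: "z \<in> closure \<Omega>"
    using well_prepared_leading(5)[OF wp z] well_prepared_leading(5)[OF wp z0(1)] z0(2)
    by (simp add: leading_def)
qed

text \<open>
  The sound speed is finite because its square is, so both maximal speeds are finite as well.  The
  substitution of \<open>\<epsilon>\<^sup>2\<close> for \<open>\<epsilon>\<close> used in the time-step formula preserves order zero and the
  coefficient there.
\<close>

lemma cfl_time_step_order_zero:
  assumes wp: "well_prepared \<Omega> p0 p1 S" and pos: "positive_density \<Omega> S"
    and max: "is_max_on (closure \<Omega>) (rho S) R" and min: "is_min_on (closure \<Omega>) (prs S) Q"
    and K: "0 < K" "0 < \<Delta>x" "0 < \<Delta>y"
    and cfl: "cfl_time_step \<Omega> \<gamma> K \<Delta>x \<Delta>y S R Q dt"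
  shows "leading dt 0 (fls_nth dt 0)" "0 < fls_nth dt 0"
proof -
  obtain c a b where c: "\<And>z. z \<in> closure \<Omega> \<Longrightarrow> 0 \<le> c z \<and> (c z)\<^sup>2 = fls_compose_power
             (1 / eps\<^sup>2 * (fls_const \<gamma> * ((R - rho S z) * (prs S z - Q) / (rho S z * R)))) 2"
    and a: "is_max_on (closure \<Omega>) (\<lambda>z. \<bar>fls_compose_power (velx S z) 2\<bar> + c z) a"
    and b: "is_max_on (closure \<Omega>) (\<lambda>z. \<bar>fls_compose_power (vely S z) 2\<bar> + c z) b"
    and nz: "a \<noteq> 0" "b \<noteq> 0"
    and dt: "fls_compose_power dt 2 = fls_const K * min (fls_const \<Delta>x / a) (fls_const \<Delta>y / b)"
    and nz0: "fls_nth a 0 \<noteq> 0 \<or> fls_nth b 0 \<noteq> 0"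
    using cfl unfolding cfl_time_step_def by blast
  have c0: "leading (c z) 0 (fls_nth (c z) 0)" if z: "z \<in> closure \<Omega>" for z
  proof -
    have "rho (limit_state S) z \<noteq> 0" using pos z by (force simp: positive_density_def limit_state_def)
    with max_density_leading(2)[OF wp pos max]
    have "leading ((c z)\<^sup>2) 0 (\<gamma> * ((max_density \<Omega> (limit_state S) - rho (limit_state S) z) *
        fls_nth (prs S z - Q) 2 / (rho (limit_state S) z * max_density \<Omega> (limit_state S))))"
      using c[OF z] well_prepared_leading(1)[OF wp z] max_density_leading(1)[OF wp pos max]
        min_pressure_leading(2)[OF wp min z]
      by (simp only:) (intro leading_compose_square leading_cfl_term; simp)
    thus ?thesis by (rule leading_sqrt)
  qed
  have speed: "leading s 0 (fls_nth s 0) \<and> 0 < s"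
    if s: "is_max_on (closure \<Omega>) (\<lambda>z. \<bar>fls_compose_power (v z) 2\<bar> + c z) s" "s \<noteq> 0"
      and v: "\<And>z. z \<in> closure \<Omega> \<Longrightarrow> leading (v z) 0 (v0 z)" for s v v0
  proof -
    obtain z where z: "z \<in> closure \<Omega>" "s = \<bar>fls_compose_power (v z) 2\<bar> + c z"
      using s(1) unfolding is_max_on_def by blast
    have "0 \<le> s" using z(2) c[OF z(1)] by simp
    moreover have "leading s 0 (fls_nth s 0)"
      using leading_add[OF leading_abs[OF leading_compose_square[OF v[OF z(1)]]] c0[OF z(1)]]
      unfolding z(2)[symmetric] by (simp add: leading_def)
    ultimately show ?thesis using s(2) by simp
  qed
  let ?q = "fls_const K * min (fls_const \<Delta>x / a) (fls_const \<Delta>y / b)"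
  have "leading ?q 0 (fls_nth ?q 0) \<and> 0 < fls_nth ?q 0"
    using speed[OF a nz(1) well_prepared_leading(2)[OF wp]] speed[OF b nz(2) well_prepared_leading(3)[OF wp]] K nz0
    by (intro min_quotient_order_zero) auto
  hence q: "leading (fls_compose_power dt 2) 0 (fls_nth ?q 0)" "0 < fls_nth ?q 0"
    by (simp_all add: dt)
  have "fls_nth dt k = fls_nth (fls_compose_power dt 2) (2 * k)" for k
    by (simp add: fls_nth_compose_square)
  with q show "leading dt 0 (fls_nth dt 0)" "0 < fls_nth dt 0" by (auto simp: leading_def)
qed

lemma dirichlet_pressure_frontier:
  assumes "dirichlet_pressure \<Omega> p0 p1 S" "z \<in> frontier \<Omega>" "k < 2"
  shows "fls_nth (prs S z) k = background_pressure p0 p1 k"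
proof -
  obtain pb :: "nat \<Rightarrow> real \<times> real \<Rightarrow> real" where
    "prs S z = fps_to_fls (Abs_fps (\<lambda>k. if k = 0 then p0 else if k = 1 then p1 else pb k z))"
    using assms unfolding dirichlet_pressure_def by blast
  thus ?thesis using assms(3) by (auto simp: background_pressure_def nat_eq_iff)
qed

text \<open>
  The equations of a stage hold in the open domain only; continuity carries the absence of negative powers
  to the boundary.
\<close>

lemma regular_field_order_zero_closure:
  assumes "regular_field \<Omega> f" and "\<And>w. w \<in> \<Omega> \<Longrightarrow> leading (f w) 0 (g w)"
    and "k < 0" "z \<in> closure \<Omega>"
  shows "coef f k z = 0"
proof (rule continuous_constant_on_closure[OF _ _ assms(4)])
  show "continuous_on (closure \<Omega>) (coef f k)" using assms(1) unfolding regular_field_def by blast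
  show "coef f k w = 0" if "w \<in> \<Omega>" for w
    using assms(2)[OF that] assms(3) by (simp add: leading_def coef_def)
qed

lemma well_preparedI:
  assumes "\<forall>k<0. \<forall>z\<in>closure \<Omega>. coef (rho S) k z = 0"
    "(\<forall>k<2. \<forall>z\<in>closure \<Omega>. coef (prs S) k z = background_pressure p0 p1 k) \<and>
         (\<forall>k<0. \<forall>z\<in>closure \<Omega>. coef (velx S) k z = 0 \<and> coef (vely S) k z = 0) \<and>
         (\<forall>k<2. \<forall>z\<in>\<Omega>. dx (coef (velx S) k) z + dy (coef (vely S) k) z = 0)"
  shows "well_prepared \<Omega> p0 p1 S"
  using assms unfolding well_prepared_def by (simp add: background_pressure_def)


section \<open>The two stages and the asymptotic preserving property\<close>

text \<open>
  All explicit terms are of order zero: negative powers of \<open>\<epsilon>\<close> occur only in front of pressure gradients, which are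
  of order two.  The explicit part of the pressure equation agrees with the old pressure up to order
  one.  The core lemma thus makes the intermediate state well prepared, and then the implicit
  gradient is of order two too; comparing the coefficients of order zero gives the limit increment.
\<close>

lemma si_dec_stage1_limit:
  assumes \<Omega>: "open \<Omega>" "bounded \<Omega>" and \<gamma>: "0 < \<gamma>" and p0: "0 < p0"
    and dt: "leading dt 0 d" "0 < d"
    and wp: "well_prepared \<Omega> p0 p1 S" and pos: "positive_density \<Omega> S"
    and reg: "regular_flow \<Omega> Ss" and bd: "dirichlet_pressure \<Omega> p0 p1 Ss"
    and max: "is_max_on (closure \<Omega>) (rho S) rmax" and min: "is_min_on (closure \<Omega>) (prs S) pmin"
    and stage: "si_dec_stage1 \<Omega> \<gamma> dt rmax pmin S Ss"
  shows "well_prepared \<Omega> p0 p1 Ss"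
    and "z \<in> \<Omega> \<Longrightarrow> evolved (limit_state Ss) z = evolved (limit_state S) z
      + d *\<^sub>R limit_increment1 \<Omega> (limit_state S) (limit_state Ss) z"
proof -
  let ?y = "limit_state S" and ?ys = "limit_state Ss"
  define r where "r = max_density \<Omega> ?y"
  have R: "leading rmax 0 r" and r: "0 < r"
    unfolding r_def by (rule max_density_leading[OF wp pos max])+
  have pmin: "leading pmin 0 p0" by (rule min_pressure_leading(1)[OF wp min])
  have sub: "z \<in> closure \<Omega>" if "z \<in> \<Omega>" for z using that closure_subset by blast
  note at = well_prepared_leading[OF wp sub] and der = well_prepared_leading_derivatives[OF \<Omega>(1) wp]
  have rho_pos: "0 < rho ?y z" if "z \<in> \<Omega>" for z
    using pos sub[OF that] by (simp add: positive_density_def limit_state_def)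
  have S: "rho Ss z = rho S z - dt * Mass_flux_div S z"
     "velx Ss z = velx S z
       - dt * (Adv S (velx S) z + (rmax - rho S z) / (eps\<^sup>2 * rho S z * rmax) * Dx (prs S) z)
       - dt / (eps\<^sup>2 * rmax) * Dx (prs Ss) z"
     "vely Ss z = vely S z
       - dt * (Adv S (vely S) z + (rmax - rho S z) / (eps\<^sup>2 * rho S z * rmax) * Dy (prs S) z)
       - dt / (eps\<^sup>2 * rmax) * Dy (prs Ss) z"
     "prs Ss z = prs S z
       - dt * (Adv S (prs S) z + fls_const \<gamma> * (prs S z - pmin) * DivU S z)
       - dt * fls_const \<gamma> * pmin * Div (velx Ss) (vely Ss) z" if "z \<in> \<Omega>" for z
    using stage that unfolding si_dec_stage1_def DivU_def by blast+
  have rho_lim: "leading (rho Ss z) 0 (rho ?y z - d * mass_flux_div ?y z)" if z: "z \<in> \<Omega>" for z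
    unfolding S(1)[OF z] by (intro leading_diff leading_mult_unit dt at(1) der(1) z)
  let ?f = "\<lambda>z. velx ?y z - d * (adv ?y (velx ?y) z + (r - rho ?y z) / (rho ?y z * r) * dx (prs ?y) z)"
  let ?g = "\<lambda>z. vely ?y z - d * (adv ?y (vely ?y) z + (r - rho ?y z) / (rho ?y z * r) * dy (prs ?y) z)"
  let ?F = "\<lambda>z. velx S z
       - dt * (Adv S (velx S) z + (rmax - rho S z) / (eps\<^sup>2 * rho S z * rmax) * Dx (prs S) z)"
  let ?G = "\<lambda>z. vely S z
       - dt * (Adv S (vely S) z + (rmax - rho S z) / (eps\<^sup>2 * rho S z * rmax) * Dy (prs S) z)"
  let ?B = "\<lambda>z. prs S z - dt * (Adv S (prs S) z + fls_const \<gamma> * (prs S z - pmin) * DivU S z)"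
  have F: "leading (?F z) 0 (?f z)" and G: "leading (?G z) 0 (?g z)" if z: "z \<in> \<Omega>" for z
    using rho_pos[OF z] r
    by (intro leading_diff leading_mult_unit leading_add leading_explicit_pressure dt R at der z; simp)+
  have B: "fls_nth (?B z) k = background_pressure p0 p1 k" if z: "z \<in> \<Omega>" and k: "k < 2" for z k
  proof -
    have "leading (fls_const \<gamma> * (prs S z - pmin) * DivU S z) (0 + 2 + 2)
        (\<gamma> * fls_nth (prs S z - pmin) 2 * fls_nth (DivU S z) 2)"
      by (intro leading_mult leading_const min_pressure_leading(2)[OF wp min] der z sub)
    hence "leading (fls_const \<gamma> * (prs S z - pmin) * DivU S z) 2 0" by (rule leading_weaken) simp
    hence "leading (dt * (Adv S (prs S) z + fls_const \<gamma> * (prs S z - pmin) * DivU S z)) 2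
        (d * (adv ?y (prs ?y) z + 0))"
      by (intro leading_mult_unit leading_add dt der z)
    thus ?thesis using at(5)[OF z k] k by (simp add: leading_def)
  qed
  have C: "leading (dt / (eps\<^sup>2 * rmax)) (- 2) (d / r)"
    using leading_divide[OF dt(1) leading_mult[OF leading_eps_squared R]] r by simp
  have Q: "leading (dt * fls_const \<gamma> * pmin) 0 (d * \<gamma> * p0)"
    by (intro leading_mult_unit dt pmin leading_const)
  have reg': "regular_field \<Omega> (rho Ss)" "regular_field \<Omega> (velx Ss)" "regular_field \<Omega> (vely Ss)"
    "regular_field \<Omega> (prs Ss)" using reg by (auto simp: regular_flow_def)
  show wps: "well_prepared \<Omega> p0 p1 Ss"
  proof (rule well_preparedI)
    show "\<forall>k<0. \<forall>z\<in>closure \<Omega>. coef (rho Ss) k z = 0"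
      using regular_field_order_zero_closure[OF reg'(1) rho_lim] by blast
  qed (rule implicit_pressure_velocity_expansion[OF \<Omega> reg'(2-4) C _ Q _ S(2) F S(3) G S(4) B
        dirichlet_pressure_frontier[OF bd]]; use r dt \<gamma> p0 in simp)
  show "evolved ?ys z = evolved ?y z + d *\<^sub>R limit_increment1 \<Omega> ?y ?ys z" if z: "z \<in> \<Omega>"
  proof -
    note ats = well_prepared_leading[OF wps sub[OF z]]
      and ders = well_prepared_leading_derivatives[OF \<Omega>(1) wps z]
    have "leading (velx Ss z) (- 2 + 2) (?f z - d / r * dx (prs ?ys) z)"
      unfolding S(2)[OF z] using leading_diff[OF F[OF z]] leading_mult[OF C ders(4)] by simp
    hence "velx ?ys z = ?f z - d / r * dx (prs ?ys) z"
      using ats(2) by (simp add: leading_def)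
    moreover have "leading (vely Ss z) (- 2 + 2) (?g z - d / r * dy (prs ?ys) z)"
      unfolding S(3)[OF z] using leading_diff[OF G[OF z]] leading_mult[OF C ders(5)] by simp
    hence "vely ?ys z = ?g z - d / r * dy (prs ?ys) z"
      using ats(3) by (simp add: leading_def)
    moreover have "rho ?ys z = rho ?y z - d * mass_flux_div ?y z"
      using rho_lim[OF z] ats(1) by (simp add: leading_def)
    ultimately show ?thesis
      by (simp add: evolved_def limit_increment1_def Let_def r_def[symmetric] algebra_simps)
  qed
qed

text \<open>
  As in the first stage, now with two well-prepared states in the explicit terms.  The correction
  \<open>\<Delta>t/(2 \<epsilon>\<^sup>2) (\<nabla>p\<^sup>n/\<rho>\<^sub>m\<^sub>a\<^sub>x\<^sup>n - \<nabla>p\<^sup>*/\<rho>\<^sub>m\<^sub>a\<^sub>x\<^sup>*)\<close> is of order zero because both gradients are of order two.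
\<close>

lemma si_dec_stage2_limit:
  assumes \<Omega>: "open \<Omega>" "bounded \<Omega>" and \<gamma>: "0 < \<gamma>" and p0: "0 < p0"
    and dt: "leading dt 0 d" "0 < d"
    and wp: "well_prepared \<Omega> p0 p1 S" and pos: "positive_density \<Omega> S"
    and wps: "well_prepared \<Omega> p0 p1 Ss" and poss: "positive_density \<Omega> Ss"
    and reg: "regular_flow \<Omega> S'" and bd: "dirichlet_pressure \<Omega> p0 p1 S'"
    and max: "is_max_on (closure \<Omega>) (rho S) rmax" and min: "is_min_on (closure \<Omega>) (prs S) pmin"
    and maxs: "is_max_on (closure \<Omega>) (rho Ss) rmaxs" and mins: "is_min_on (closure \<Omega>) (prs Ss) pmins"
    and stage: "si_dec_stage2 \<Omega> \<gamma> dt rmax pmin rmaxs pmins S Ss S'"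
  shows "well_prepared \<Omega> p0 p1 S'"
    and "z \<in> \<Omega> \<Longrightarrow> evolved (limit_state S') z = evolved (limit_state S) z
      + d *\<^sub>R limit_increment2 \<Omega> (limit_state S) (limit_state Ss) (limit_state S') z"
proof -
  let ?y = "limit_state S" and ?ys = "limit_state Ss" and ?y' = "limit_state S'"
  define r rs where "r = max_density \<Omega> ?y" and "rs = max_density \<Omega> ?ys"
  have R: "leading rmax 0 r" and r: "0 < r"
    unfolding r_def by (rule max_density_leading[OF wp pos max])+
  have Rs: "leading rmaxs 0 rs" and rs: "0 < rs"
    unfolding rs_def by (rule max_density_leading[OF wps poss maxs])+
  have pmin: "leading pmin 0 p0" by (rule min_pressure_leading(1)[OF wp min])
  have pmins: "leading pmins 0 p0" by (rule min_pressure_leading(1)[OF wps mins])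
  have sub: "z \<in> closure \<Omega>" if "z \<in> \<Omega>" for z using that closure_subset by blast
  note at = well_prepared_leading[OF wp sub] and der = well_prepared_leading_derivatives[OF \<Omega>(1) wp]
    and ats = well_prepared_leading[OF wps sub] and ders = well_prepared_leading_derivatives[OF \<Omega>(1) wps]
  have rho_pos: "0 < rho ?y z" "0 < rho ?ys z" if "z \<in> \<Omega>" for z
    using pos poss sub[OF that] by (simp_all add: positive_density_def limit_state_def)
  let ?F = "\<lambda>z. velx S z
       - dt / 2 * (Adv S (velx S) z + Adv Ss (velx Ss) z
           + (rmax - rho S z) / (eps\<^sup>2 * rho S z * rmax) * Dx (prs S) z
           + (rmaxs - rho Ss z) / (eps\<^sup>2 * rho Ss z * rmaxs) * Dx (prs Ss) z)
       - dt / (2 * eps\<^sup>2) * (Dx (prs S) z / rmax - Dx (prs Ss) z / rmaxs)"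
  let ?G = "\<lambda>z. vely S z
       - dt / 2 * (Adv S (vely S) z + Adv Ss (vely Ss) z
           + (rmax - rho S z) / (eps\<^sup>2 * rho S z * rmax) * Dy (prs S) z
           + (rmaxs - rho Ss z) / (eps\<^sup>2 * rho Ss z * rmaxs) * Dy (prs Ss) z)
       - dt / (2 * eps\<^sup>2) * (Dy (prs S) z / rmax - Dy (prs Ss) z / rmaxs)"
  let ?B = "\<lambda>z. prs S z
       - dt / 2 * (Adv S (prs S) z + Adv Ss (prs Ss) z
           + fls_const \<gamma> * (prs S z - pmin) * DivU S z
           + fls_const \<gamma> * (prs Ss z - pmins) * DivU Ss z)
       - dt / 2 * fls_const \<gamma> * (pmin * DivU S z - pmins * DivU Ss z)"
  let ?f = "\<lambda>z. velx ?y z - d / 2 * (adv ?y (velx ?y) z + adv ?ys (velx ?ys) z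
       + (r - rho ?y z) / (rho ?y z * r) * dx (prs ?y) z
       + (rs - rho ?ys z) / (rho ?ys z * rs) * dx (prs ?ys) z)
       - d / 2 * (dx (prs ?y) z / r - dx (prs ?ys) z / rs)"
  let ?g = "\<lambda>z. vely ?y z - d / 2 * (adv ?y (vely ?y) z + adv ?ys (vely ?ys) z
       + (r - rho ?y z) / (rho ?y z * r) * dy (prs ?y) z
       + (rs - rho ?ys z) / (rho ?ys z * rs) * dy (prs ?ys) z)
       - d / 2 * (dy (prs ?y) z / r - dy (prs ?ys) z / rs)"
  have S: "rho S' z = rho S z - dt / 2 * (Mass_flux_div S z + Mass_flux_div Ss z)"
     "velx S' z = ?F z - dt / (eps\<^sup>2 * rmaxs) * Dx (prs S') z"
     "vely S' z = ?G z - dt / (eps\<^sup>2 * rmaxs) * Dy (prs S') z"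
     "prs S' z = ?B z - dt * fls_const \<gamma> * pmins * Div (velx S') (vely S') z" if "z \<in> \<Omega>" for z
    using stage that unfolding si_dec_stage2_def DivU_def by blast+
  have dt2: "leading (dt / 2) 0 (d / 2)"
    by (intro leading_divide_unit dt leading_numeral) simp
  have rho_lim: "leading (rho S' z) 0 (rho ?y z - d / 2 * (mass_flux_div ?y z + mass_flux_div ?ys z))"
    if z: "z \<in> \<Omega>" for z
    unfolding S(1)[OF z] by (intro leading_diff leading_mult_unit leading_add dt2 at(1) der(1) ders(1) z)
  have gradient_correction: "leading (dt / (2 * eps\<^sup>2) * (X / rmax - Y / rmaxs)) 0 (d / 2 * (x / r - y / rs))"
    if "leading X 2 x" "leading Y 2 y" for X Y x y
  proof -
    have "leading (dt / (2 * eps\<^sup>2)) (0 - (0 + 2)) (d / (2 * 1))"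
      by (intro leading_divide leading_mult dt leading_numeral leading_eps_squared) simp
    moreover have "leading (X / rmax - Y / rmaxs) 2 (x / r - y / rs)"
      using r rs by (intro leading_diff leading_divide_unit that R Rs) simp_all
    ultimately show ?thesis using leading_mult by fastforce
  qed
  have F: "leading (?F z) 0 (?f z)" and G: "leading (?G z) 0 (?g z)" if z: "z \<in> \<Omega>" for z
    using rho_pos[OF z] r rs
    by (intro leading_diff[OF _ gradient_correction] leading_diff[OF _ leading_mult_unit[OF dt2]] leading_add
        leading_explicit_pressure R Rs at ats der ders z; simp)+
  have B: "fls_nth (?B z) k = background_pressure p0 p1 k" if z: "z \<in> \<Omega>" and k: "k < 2" for z k
  proof -
    have "leading (fls_const \<gamma> * (prs S z - pmin) * DivU S z) (0 + 2 + 2)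
        (\<gamma> * fls_nth (prs S z - pmin) 2 * fls_nth (DivU S z) 2)"
      by (intro leading_mult leading_const min_pressure_leading(2)[OF wp min] der z sub)
    hence c1: "leading (fls_const \<gamma> * (prs S z - pmin) * DivU S z) 2 0" by (rule leading_weaken) simp
    have "leading (fls_const \<gamma> * (prs Ss z - pmins) * DivU Ss z) (0 + 2 + 2)
        (\<gamma> * fls_nth (prs Ss z - pmins) 2 * fls_nth (DivU Ss z) 2)"
      by (intro leading_mult leading_const min_pressure_leading(2)[OF wps mins] ders z sub)
    hence c2: "leading (fls_const \<gamma> * (prs Ss z - pmins) * DivU Ss z) 2 0" by (rule leading_weaken) simp
    have "leading (dt / 2 * (Adv S (prs S) z + Adv Ss (prs Ss) z
           + fls_const \<gamma> * (prs S z - pmin) * DivU S z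
           + fls_const \<gamma> * (prs Ss z - pmins) * DivU Ss z)) 2
        (d / 2 * (adv ?y (prs ?y) z + adv ?ys (prs ?ys) z + 0 + 0))"
      by (intro leading_mult_unit leading_add dt2 der ders c1 c2 z)
    moreover have "leading (dt / 2 * fls_const \<gamma> * (pmin * DivU S z - pmins * DivU Ss z)) 2
        (d / 2 * \<gamma> * (p0 * fls_nth (DivU S z) 2 - p0 * fls_nth (DivU Ss z) 2))"
      by (intro leading_mult_unit leading_diff dt2 leading_const der ders pmin pmins z)
    ultimately show ?thesis using at(5)[OF z k] k by (simp add: leading_def)
  qed
  have C: "leading (dt / (eps\<^sup>2 * rmaxs)) (- 2) (d / rs)"
    using leading_divide[OF dt(1) leading_mult[OF leading_eps_squared Rs]] rs by simp
  have Q: "leading (dt * fls_const \<gamma> * pmins) 0 (d * \<gamma> * p0)"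
    by (intro leading_mult_unit dt pmins leading_const)
  have reg': "regular_field \<Omega> (rho S')" "regular_field \<Omega> (velx S')" "regular_field \<Omega> (vely S')"
    "regular_field \<Omega> (prs S')" using reg by (auto simp: regular_flow_def)
  show wp': "well_prepared \<Omega> p0 p1 S'"
  proof (rule well_preparedI)
    show "\<forall>k<0. \<forall>z\<in>closure \<Omega>. coef (rho S') k z = 0"
      using regular_field_order_zero_closure[OF reg'(1) rho_lim] by blast
  qed (rule implicit_pressure_velocity_expansion[OF \<Omega> reg'(2-4) C _ Q _ S(2) F S(3) G S(4) B
        dirichlet_pressure_frontier[OF bd]]; use rs dt \<gamma> p0 in simp)
  show "evolved ?y' z = evolved ?y z + d *\<^sub>R limit_increment2 \<Omega> ?y ?ys ?y' z" if z: "z \<in> \<Omega>"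
  proof -
    note at' = well_prepared_leading[OF wp' sub[OF z]]
      and der' = well_prepared_leading_derivatives[OF \<Omega>(1) wp' z]
    have "leading (velx S' z) (- 2 + 2) (?f z - d / rs * dx (prs ?y') z)"
      unfolding S(2)[OF z] using leading_diff[OF F[OF z]] leading_mult[OF C der'(4)] by simp
    hence velx': "velx ?y' z = ?f z - d / rs * dx (prs ?y') z"
      using at'(2) by (simp add: leading_def)
    have "leading (vely S' z) (- 2 + 2) (?g z - d / rs * dy (prs ?y') z)"
      unfolding S(3)[OF z] using leading_diff[OF G[OF z]] leading_mult[OF C der'(5)] by simp
    hence vely': "vely ?y' z = ?g z - d / rs * dy (prs ?y') z"
      using at'(3) by (simp add: leading_def)
    have rho': "rho ?y' z = rho ?y z - d / 2 * (mass_flux_div ?y z + mass_flux_div ?ys z)"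
      using rho_lim[OF z] at'(1) by (simp add: leading_def)
    \<comment> \<open>The limit increment with its factor \<open>d\<close> pulled out of the sum.\<close>
    have collect: "u - d / 2 * X - d / 2 * Y - d / rs * g = u + d * (- X / 2 - Y / 2 - 1 / rs * g)"
      for u X Y g :: real by (simp add: algebra_simps)
    show ?thesis
      unfolding evolved_def limit_increment2_def Let_def r_def[symmetric] rs_def[symmetric]
        velx' vely' rho' collect scaleR_prod_def plus_prod_def
      by (simp add: field_simps)
  qed
qed

theorem theorem3p2:
  fixes \<Omega> :: "(real \<times> real) set"
    and \<gamma> K \<Delta>x \<Delta>y p0 p1 :: real
  assumes "open \<Omega>" "connected \<Omega>" "bounded \<Omega>" "\<Omega> \<noteq> {}"
    and "\<gamma> > 0" "K > 0" "\<Delta>x > 0" "\<Delta>y > 0" "p0 > 0"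
  shows "asymptotic_preserving \<Omega> p0 p1 (si_dec \<Omega> \<gamma> K \<Delta>x \<Delta>y)
    (limit_increment1 \<Omega>) (limit_increment2 \<Omega>)"
  unfolding asymptotic_preserving_def
proof (rule conjI)
  show "consistent_increments \<Omega> (limit_increment1 \<Omega>) (limit_increment2 \<Omega>)"
    using assms by (intro limit_increments_consistent)
  show "\<forall>dt Sn Ss Sn'.
        regular_flow \<Omega> Sn \<and> regular_flow \<Omega> Ss \<and> regular_flow \<Omega> Sn' \<and>
        positive_density \<Omega> Sn \<and> positive_density \<Omega> Ss \<and>
        well_prepared \<Omega> p0 p1 Sn \<and>
        dirichlet_pressure \<Omega> p0 p1 Sn \<and> dirichlet_pressure \<Omega> p0 p1 Ss \<and>
        dirichlet_pressure \<Omega> p0 p1 Sn' \<and>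
        si_dec \<Omega> \<gamma> K \<Delta>x \<Delta>y dt Sn Ss Sn' \<longrightarrow>
          well_prepared \<Omega> p0 p1 Ss \<and> well_prepared \<Omega> p0 p1 Sn' \<and>
          (\<forall>k<0. fls_nth dt k = 0) \<and> 0 < fls_nth dt 0 \<and>
          (\<forall>z\<in>\<Omega>.
             evolved (limit_state Ss) z = evolved (limit_state Sn) z
               + fls_nth dt 0 *\<^sub>R limit_increment1 \<Omega> (limit_state Sn) (limit_state Ss) z \<and>
             evolved (limit_state Sn') z = evolved (limit_state Sn) z
               + fls_nth dt 0 *\<^sub>R limit_increment2 \<Omega> (limit_state Sn) (limit_state Ss) (limit_state Sn') z)"
  proof (intro allI impI, elim conjE)
    fix dt Sn Ss Sn'
    assume reg: "regular_flow \<Omega> Ss" "regular_flow \<Omega> Sn'"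
      and pos: "positive_density \<Omega> Sn" "positive_density \<Omega> Ss"
      and wp: "well_prepared \<Omega> p0 p1 Sn"
      and bd: "dirichlet_pressure \<Omega> p0 p1 Ss" "dirichlet_pressure \<Omega> p0 p1 Sn'"
      and "si_dec \<Omega> \<gamma> K \<Delta>x \<Delta>y dt Sn Ss Sn'"
    then obtain rmax pmin rmaxs pmins where
      ext: "is_max_on (closure \<Omega>) (rho Sn) rmax" "is_min_on (closure \<Omega>) (prs Sn) pmin"
        "is_max_on (closure \<Omega>) (rho Ss) rmaxs" "is_min_on (closure \<Omega>) (prs Ss) pmins"
      and cfl: "cfl_time_step \<Omega> \<gamma> K \<Delta>x \<Delta>y Sn rmax pmin dt"
      and s1: "si_dec_stage1 \<Omega> \<gamma> dt rmax pmin Sn Ss"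
      and s2: "si_dec_stage2 \<Omega> \<gamma> dt rmax pmin rmaxs pmins Sn Ss Sn'"
      unfolding si_dec_def by blast
    note dt = cfl_time_step_order_zero[OF wp pos(1) ext(1,2) \<open>K > 0\<close> \<open>\<Delta>x > 0\<close> \<open>\<Delta>y > 0\<close> cfl]
    note stage1 = si_dec_stage1_limit[OF \<open>open \<Omega>\<close> \<open>bounded \<Omega>\<close> \<open>\<gamma> > 0\<close> \<open>p0 > 0\<close> dt wp pos(1)
        reg(1) bd(1) ext(1,2) s1]
    note stage2 = si_dec_stage2_limit[OF \<open>open \<Omega>\<close> \<open>bounded \<Omega>\<close> \<open>\<gamma> > 0\<close> \<open>p0 > 0\<close> dt wp pos(1)
        stage1(1) pos(2) reg(2) bd(2) ext s2]
    show "well_prepared \<Omega> p0 p1 Ss \<and> well_prepared \<Omega> p0 p1 Sn' \<and>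
          (\<forall>k<0. fls_nth dt k = 0) \<and> 0 < fls_nth dt 0 \<and>
          (\<forall>z\<in>\<Omega>.
             evolved (limit_state Ss) z = evolved (limit_state Sn) z
               + fls_nth dt 0 *\<^sub>R limit_increment1 \<Omega> (limit_state Sn) (limit_state Ss) z \<and>
             evolved (limit_state Sn') z = evolved (limit_state Sn) z
               + fls_nth dt 0 *\<^sub>R limit_increment2 \<Omega> (limit_state Sn) (limit_state Ss) (limit_state Sn') z)"
      using stage1 stage2 dt by (auto simp: leading_def)
  qed
qed

end
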